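(* Let $\alpha:F\Rightarrow G:\mathbf{C}\to\mathbf{D}$ be a 2-morphism of small pre-natural models. Then: (1) for every $\Gamma\in\mathbf{C}$ and $A\in\mathbf{Tp}_{\mathbf{C}}(\Gamma)$, the following morphisms $Fp_A\to p_{(GA)[\alpha_\Gamma]}$ of $\mathcal{D}_{\mathbf{D}}(F\Gamma)$ are equal: $$\mathrm{comp}_{\mathbf{D}}(\alpha_A)\circ(\tau_F)_A=(\rho_{\alpha_\Gamma})_{GA}\circ(\alpha_\Gamma)^*(\tau_G)_A\circ(\mathcal{D}_\alpha)_{p_A};$$ (2) for every $\Gamma\in\mathbf{C}$ and $a\in\mathbf{Tm}_{\mathbf{C}}(\Gamma)$, the following morphisms $F\overline{a}\to\overline{(Ga)[\alpha_\Gamma]}$ of $(\mathcal{D}_\bullet)_{\mathbf{D}}(F\Gamma)$ are equal: $$(\mathrm{comp}_\bullet)_{\mathbf{D}}(\alpha_a)\circ((\tau_\bullet)_F)_a=((\rho_\bullet)_{\alpha_\Gamma})_{Ga}\circ(\alpha_\Gamma)^*((\tau_\bullet)_G)_a\circ((\mathcal{D}_\bullet)_\alpha)_{\overline{a}}.$$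
   Context: **Display categories.** A display category $\mathbf{C}$ is a category (also denoted $\mathbf{C}$) with a class $\mathcal{D}_{\mathbf{C}}$ of morphisms, called displays, such that every display $p:E\to B$ has, along every $f:A\to B$, a pullback $f^*p:f^*E\to A$ that is a display, and $\mathcal{D}_{\mathbf{C}}$ is closed under composition with isomorphisms. A choice of such pullbacks is fixed. $\mathcal{D}_{\mathbf{C}}$ also denotes the $\mathbf{C}$-indexed category (pseudofunctor $\mathbf{C}^{\mathrm{op}}\to\mathbf{Cat}$) whose value at $A$ is the full subcategory of $\mathbf{C}/A$ on displays, with reindexing by chosen pullbacks; $(\mathcal{D}_\bullet)_{\mathbf{C}}(A)$ is the category of pairs $(p,s)$ of a display $p$ with codomain $A$ and a section $s$ of $p$ (morphisms: those of $\mathcal{D}_{\mathbf{C}}(A)$ commuting with the sections), with reindexing by chosen pullbacks; a pair may be denoted by its section. A display functor takes displays to displays and pullbacks of displays to pullbacks of displays. A natural transformation $\alpha:F\Rightarrow G:\mathbf{C}\to\mathbf{D}$ between display functors induces, for each display $p:E\to B$ of $\mathbf{C}$, the map $(\mathcal{D}_\alpha)_p:Fp\to(\alpha_B)^*(Gp)$ over $FB$ determined by $\alpha_E:FE\to GE$ and $Fp$; for a section $s$ of $p$, the same map gives $((\mathcal{D}_\bullet)_\alpha)_s:Fs\to(\alpha_B)^*(Gs)$ in $(\mathcal{D}_\bullet)_{\mathbf{D}}(FB)$. **Pre-natural models.** A small pre-natural model $\mathbf{C}$ is a small display category $\mathbf{C}$ with small strict $\mathbf{C}$-indexed categories $\mathbf{Tp}_{\mathbf{C}},\mathbf{Tm}_{\mathbf{C}}:\mathbf{C}^{\mathrm{op}}\to\mathbf{Cat}$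 (strict functors) and a strictly natural $p_{\mathbf{C}}:\mathbf{Tm}_{\mathbf{C}}\to\mathbf{Tp}_{\mathbf{C}}$, each component of which is a discrete opfibration, that is representable: for $A\in\mathbf{Tp}_{\mathbf{C}}(\Gamma)$, the presheaf $\Delta\mapsto\{(u:\Delta\to\Gamma,\ t\in\mathbf{Tm}_{\mathbf{C}}(\Delta)):p_{\mathbf{C}}(t)=A[u]\}$ over $\Gamma$ is represented by a (chosen) display $p_A:\Gamma.A\to\Gamma$ with universal element $v_A\in\mathbf{Tm}_{\mathbf{C}}(\Gamma.A)$. Here $A[u]=\mathbf{Tp}_{\mathbf{C}}(u)(A)$, similarly for morphisms and terms. The $\mathbf{C}$-indexed functor $\mathrm{comp}_{\mathbf{C}}:\mathbf{Tp}_{\mathbf{C}}\to\mathcal{D}_{\mathbf{C}}$ sends $A$ to $p_A$ and $f:A\to B$ in $\mathbf{Tp}_{\mathbf{C}}(\Gamma)$ to the map $\Gamma.f:\Gamma.A\to\Gamma.B$ over $\Gamma$ with $v_B[\Gamma.f]$ the codomain of the unique lift of $f[p_A]$ with domain $v_A$. The $\mathbf{C}$-indexed functor $(\mathrm{comp}_\bullet)_{\mathbf{C}}:\mathbf{Tm}_{\mathbf{C}}\to(\mathcal{D}_\bullet)_{\mathbf{C}}$ sends $a\in\mathbf{Tm}_{\mathbf{C}}(\Gamma)$ with $p_{\mathbf{C}}(a)=A$ to $p_A$ with its section $\overline{a}:\Gamma\to\Gamma.A$ satisfying $v_A[\overline{a}]=a$, and a morphism $x$ to the map underlying $\mathrm{comp}_{\mathbf{C}}(p_{\mathbf{C}}(x))$.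 Their pseudonaturality isomorphisms are $(\rho_u)_A:u^*p_A\cong p_{A[u]}$, the canonical comparison of pullbacks, and $((\rho_\bullet)_u)_a:u^*\overline{a}\cong\overline{a[u]}$, given by the same underlying maps. **Morphisms and 2-morphisms.** A morphism $F:\mathbf{C}\to\mathbf{D}$ of small pre-natural models is a display functor $F$ with strictly natural $\mathbf{Tp}_F:\mathbf{Tp}_{\mathbf{C}}\to F^*\mathbf{Tp}_{\mathbf{D}}$, $\mathbf{Tm}_F:\mathbf{Tm}_{\mathbf{C}}\to F^*\mathbf{Tm}_{\mathbf{D}}$ commuting with $p_{\mathbf{C}}$ and $F^*p_{\mathbf{D}}$; write $FA,Fa$ for their values. $(\tau_F)_A:Fp_A\to p_{FA}$ is the map $F(\Gamma.A)\to F\Gamma.FA$ over $F\Gamma$ with $v_{FA}[(\tau_F)_A]=Fv_A$; for $p_{\mathbf{C}}(a)=A$, $((\tau_\bullet)_F)_a:F\overline{a}\to\overline{Fa}$ is the morphism of $(\mathcal{D}_\bullet)_{\mathbf{D}}(F\Gamma)$ with the same underlying map. A 2-morphism $\alpha:F\Rightarrow G$ of small pre-natural models is a natural transformation $\alpha:F\Rightarrow G$ with $\mathbf{C}$-indexed natural transformations $\mathbf{Tp}_\alpha:\mathbf{Tp}_F\Rightarrow\alpha^*\mathbf{Tp}_{\mathbf{D}}\circ\mathbf{Tp}_G$ and $\mathbf{Tm}_\alpha:\mathbf{Tm}_F\Rightarrow\alpha^*\mathbf{Tm}_{\mathbf{D}}\circ\mathbf{Tm}_G$, with components $\alpha_A:FA\to(GA)[\alpha_\Gamma]$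 and $\alpha_a:Fa\to(Ga)[\alpha_\Gamma]$, such that $p_{\mathbf{D}}(\alpha_a)=\alpha_{p_{\mathbf{C}}(a)}$. *)

theory Defs
  imports Main
begin

section \<open>Categories, functors, natural transformations\<close>

text \<open>
  A small category is given by carrier sets of objects and arrows; all operations are only
  meaningful on the carriers. Composition is written in applicative order.
\<close>

record ('o, 'm) category =
  Obj :: "'o set"
  Arr :: "'m set"
  Dom :: "'m \<Rightarrow> 'o"
  Cod :: "'m \<Rightarrow> 'o"
  Ident :: "'o \<Rightarrow> 'm"
  Comp :: "'m \<Rightarrow> 'm \<Rightarrow> 'm"  (infixr "\<cdot>\<index>" 70)

definition hom :: "('o, 'm, 'z) category_scheme \<Rightarrow> 'o \<Rightarrow> 'o \<Rightarrow> 'm set" where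
  "hom C a b = {f \<in> Arr C. Dom C f = a \<and> Cod C f = b}"

locale category =
  fixes C :: "('o, 'm, 'z) category_scheme" (structure)
  assumes Dom_Obj: "f \<in> Arr C \<Longrightarrow> Dom C f \<in> Obj C"
    and Cod_Obj: "f \<in> Arr C \<Longrightarrow> Cod C f \<in> Obj C"
    and Ident_hom: "a \<in> Obj C \<Longrightarrow> Ident C a \<in> hom C a a"
    and Comp_hom: "f \<in> hom C a b \<Longrightarrow> g \<in> hom C b c \<Longrightarrow> g \<cdot> f \<in> hom C a c"
    and Comp_Ident_right: "f \<in> hom C a b \<Longrightarrow> f \<cdot> Ident C a = f"
    and Comp_Ident_left: "f \<in> hom C a b \<Longrightarrow> Ident C b \<cdot> f = f"
    and Comp_assoc:
      "f \<in> hom C a b \<Longrightarrow> g \<in> hom C b c \<Longrightarrow> h \<in> hom C c d \<Longrightarrow> (h \<cdot> g) \<cdot> f = h \<cdot> (g \<cdot> f)"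

definition is_iso :: "('o, 'm, 'z) category_scheme \<Rightarrow> 'm \<Rightarrow> bool" where
  "is_iso C i \<longleftrightarrow> i \<in> Arr C \<and>
     (\<exists>j \<in> hom C (Cod C i) (Dom C i).
        j \<cdot>\<^bsub>C\<^esub> i = Ident C (Dom C i) \<and> i \<cdot>\<^bsub>C\<^esub> j = Ident C (Cod C i))"

record ('o, 'm, 'p, 'n) cfunctor =
  fobj :: "'o \<Rightarrow> 'p"
  farr :: "'m \<Rightarrow> 'n"

definition cfunctor_comp ::
  "('p, 'n, 'q, 'k) cfunctor \<Rightarrow> ('o, 'm, 'p, 'n) cfunctor \<Rightarrow> ('o, 'm, 'q, 'k) cfunctor"
  (infixr "\<circ>\<^sub>F" 55) where
  "G \<circ>\<^sub>F F = \<lparr>fobj = fobj G \<circ> fobj F, farr = farr G \<circ> farr F\<rparr>"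

locale cat_functor = dom: category C + cod: category D
  for C :: "('o, 'm, 'y) category_scheme"
    and D :: "('p, 'n, 'z) category_scheme"
    and F :: "('o, 'm, 'p, 'n) cfunctor" +
  assumes farr_hom: "f \<in> hom C a b \<Longrightarrow> farr F f \<in> hom D (fobj F a) (fobj F b)"
    and fobj_Obj: "a \<in> Obj C \<Longrightarrow> fobj F a \<in> Obj D"
    and farr_Ident: "a \<in> Obj C \<Longrightarrow> farr F (Ident C a) = Ident D (fobj F a)"
    and farr_Comp:
      "f \<in> hom C a b \<Longrightarrow> g \<in> hom C b c \<Longrightarrow> farr F (g \<cdot>\<^bsub>C\<^esub> f) = farr F g \<cdot>\<^bsub>D\<^esub> farr F f"

locale nat_trans = src: cat_functor C D F + trg: cat_functor C D G
  for C :: "('o, 'm, 'y) category_scheme"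
    and D :: "('p, 'n, 'z) category_scheme"
    and F G :: "('o, 'm, 'p, 'n) cfunctor"
    and \<alpha> :: "'o \<Rightarrow> 'n" +
  assumes component_hom: "a \<in> Obj C \<Longrightarrow> \<alpha> a \<in> hom D (fobj F a) (fobj G a)"
    and naturality:
      "f \<in> hom C a b \<Longrightarrow> \<alpha> b \<cdot>\<^bsub>D\<^esub> farr F f = farr G f \<cdot>\<^bsub>D\<^esub> \<alpha> a"

locale discrete_opfibration = cat_functor E B p
  for E :: "('o, 'm, 'y) category_scheme"
    and B :: "('p, 'n, 'z) category_scheme"
    and p :: "('o, 'm, 'p, 'n) cfunctor" +
  assumes unique_lift:
    "e \<in> Obj E \<Longrightarrow> f \<in> Arr B \<Longrightarrow> Dom B f = fobj p e \<Longrightarrow>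
       \<exists>!x. x \<in> Arr E \<and> Dom E x = e \<and> farr p x = f"


section \<open>Indexed categories\<close>

record ('o, 'm, 'a, 'b) indexed_cat =
  fib :: "'o \<Rightarrow> ('a, 'b) category"
  reind :: "'m \<Rightarrow> ('a, 'b, 'a, 'b) cfunctor"

locale strict_indexed_cat = category C
  for C :: "('o, 'm, 'z) category_scheme" (structure)
    and I :: "('o, 'm, 'a, 'b) indexed_cat" +
  assumes fib_category: "\<Gamma> \<in> Obj C \<Longrightarrow> category (fib I \<Gamma>)"
    and reind_functor: "u \<in> hom C \<Delta> \<Gamma> \<Longrightarrow> cat_functor (fib I \<Gamma>) (fib I \<Delta>) (reind I u)"
    and reind_Ident_obj:
      "\<Gamma> \<in> Obj C \<Longrightarrow> A \<in> Obj (fib I \<Gamma>) \<Longrightarrow> fobj (reind I (Ident C \<Gamma>)) A = A"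
    and reind_Ident_arr:
      "\<Gamma> \<in> Obj C \<Longrightarrow> f \<in> Arr (fib I \<Gamma>) \<Longrightarrow> farr (reind I (Ident C \<Gamma>)) f = f"
    and reind_Comp_obj:
      "w \<in> hom C \<Theta> \<Delta> \<Longrightarrow> u \<in> hom C \<Delta> \<Gamma> \<Longrightarrow> A \<in> Obj (fib I \<Gamma>) \<Longrightarrow>
         fobj (reind I (u \<cdot> w)) A = fobj (reind I w) (fobj (reind I u) A)"
    and reind_Comp_arr:
      "w \<in> hom C \<Theta> \<Delta> \<Longrightarrow> u \<in> hom C \<Delta> \<Gamma> \<Longrightarrow> f \<in> Arr (fib I \<Gamma>) \<Longrightarrow>
         farr (reind I (u \<cdot> w)) f = farr (reind I w) (farr (reind I u) f)"

locale strict_indexed_functor = dom: strict_indexed_cat C I + cod: strict_indexed_cat C J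
  for C :: "('o, 'm, 'z) category_scheme"
    and I :: "('o, 'm, 'a, 'b) indexed_cat"
    and J :: "('o, 'm, 'c, 'd) indexed_cat"
    and S :: "'o \<Rightarrow> ('a, 'b, 'c, 'd) cfunctor" +
  assumes component_functor: "\<Gamma> \<in> Obj C \<Longrightarrow> cat_functor (fib I \<Gamma>) (fib J \<Gamma>) (S \<Gamma>)"
    and strict_nat_obj:
      "u \<in> hom C \<Delta> \<Gamma> \<Longrightarrow> A \<in> Obj (fib I \<Gamma>) \<Longrightarrow>
         fobj (S \<Delta>) (fobj (reind I u) A) = fobj (reind J u) (fobj (S \<Gamma>) A)"
    and strict_nat_arr:
      "u \<in> hom C \<Delta> \<Gamma> \<Longrightarrow> f \<in> Arr (fib I \<Gamma>) \<Longrightarrow>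
         farr (S \<Delta>) (farr (reind I u) f) = farr (reind J u) (farr (S \<Gamma>) f)"

locale indexed_nat_trans = src: strict_indexed_functor C I J S + trg: strict_indexed_functor C I J T
  for C :: "('o, 'm, 'z) category_scheme"
    and I :: "('o, 'm, 'a, 'b) indexed_cat"
    and J :: "('o, 'm, 'c, 'd) indexed_cat"
    and S T :: "'o \<Rightarrow> ('a, 'b, 'c, 'd) cfunctor"
    and \<sigma> :: "'o \<Rightarrow> 'a \<Rightarrow> 'd" +
  assumes component_nat_trans:
      "\<Gamma> \<in> Obj C \<Longrightarrow> nat_trans (fib I \<Gamma>) (fib J \<Gamma>) (S \<Gamma>) (T \<Gamma>) (\<sigma> \<Gamma>)"
    and reind_component:
      "u \<in> hom C \<Delta> \<Gamma> \<Longrightarrow> A \<in> Obj (fib I \<Gamma>) \<Longrightarrow>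
         \<sigma> \<Delta> (fobj (reind I u) A) = farr (reind J u) (\<sigma> \<Gamma> A)"

text \<open>For a functor \<open>F\<close> and an indexed category \<open>I\<close> over its codomain, the reindexed \<open>F\<^sup>*I\<close>; for
  a natural transformation \<open>\<alpha> : F \<Rightarrow> G\<close>, the indexed functor \<open>\<alpha>\<^sup>*I : G\<^sup>*I \<rightarrow> F\<^sup>*I\<close>.\<close>

definition change_base ::
  "('o, 'm, 'p, 'n) cfunctor \<Rightarrow> ('p, 'n, 'a, 'b) indexed_cat \<Rightarrow> ('o, 'm, 'a, 'b) indexed_cat" where
  "change_base F I = \<lparr>fib = (\<lambda>\<Gamma>. fib I (fobj F \<Gamma>)), reind = (\<lambda>u. reind I (farr F u))\<rparr>"

definition change_base_nat ::
  "('o \<Rightarrow> 'n) \<Rightarrow> ('p, 'n, 'a, 'b) indexed_cat \<Rightarrow> 'o \<Rightarrow> ('a, 'b, 'a, 'b) cfunctor" where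
  "change_base_nat \<alpha> I = (\<lambda>\<Gamma>. reind I (\<alpha> \<Gamma>))"


section \<open>Display categories\<close>

text \<open>\<open>is_pullback C f p q t\<close>: the square with \<open>p \<cdot> t = f \<cdot> q\<close> exhibits \<open>q\<close> as a pullback of
  \<open>p\<close> along \<open>f\<close>, with projection \<open>t\<close> to the domain of \<open>p\<close>.\<close>

definition is_pullback :: "('o, 'm, 'z) category_scheme \<Rightarrow> 'm \<Rightarrow> 'm \<Rightarrow> 'm \<Rightarrow> 'm \<Rightarrow> bool" where
  "is_pullback C f p q t \<longleftrightarrow>
     f \<in> Arr C \<and> p \<in> Arr C \<and> Cod C f = Cod C p \<and>
     q \<in> hom C (Dom C q) (Dom C f) \<and> t \<in> hom C (Dom C q) (Dom C p) \<and>
     p \<cdot>\<^bsub>C\<^esub> t = f \<cdot>\<^bsub>C\<^esub> q \<and>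
     (\<forall>X \<in> Obj C. \<forall>x \<in> hom C X (Dom C f). \<forall>y \<in> hom C X (Dom C p).
        p \<cdot>\<^bsub>C\<^esub> y = f \<cdot>\<^bsub>C\<^esub> x \<longrightarrow>
        (\<exists>!h. h \<in> hom C X (Dom C q) \<and> q \<cdot>\<^bsub>C\<^esub> h = x \<and> t \<cdot>\<^bsub>C\<^esub> h = y))"

text \<open>\<open>pb C f p\<close> is the chosen pullback \<open>f\<^sup>*p : f\<^sup>*E \<rightarrow> A\<close> of a display \<open>p : E \<rightarrow> B\<close> along
  \<open>f : A \<rightarrow> B\<close>, and \<open>pb_top C f p\<close> is its projection \<open>f\<^sup>*E \<rightarrow> E\<close>.\<close>

record ('o, 'm) display_cat = "('o, 'm) category" +
  Displays :: "'m set"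
  pb :: "'m \<Rightarrow> 'm \<Rightarrow> 'm"
  pb_top :: "'m \<Rightarrow> 'm \<Rightarrow> 'm"

locale display_category = category C
  for C :: "('o, 'm, 'z) display_cat_scheme" (structure) +
  assumes Displays_Arr: "Displays C \<subseteq> Arr C"
    and pb_Displays:
      "p \<in> Displays C \<Longrightarrow> f \<in> Arr C \<Longrightarrow> Cod C f = Cod C p \<Longrightarrow> pb C f p \<in> Displays C"
    and pb_is_pullback:
      "p \<in> Displays C \<Longrightarrow> f \<in> Arr C \<Longrightarrow> Cod C f = Cod C p \<Longrightarrow>
         is_pullback C f p (pb C f p) (pb_top C f p)"
    and Displays_iso_right:
      "p \<in> Displays C \<Longrightarrow> is_iso C i \<Longrightarrow> Cod C i = Dom C p \<Longrightarrow> p \<cdot> i \<in> Displays C"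
    and Displays_iso_left:
      "p \<in> Displays C \<Longrightarrow> is_iso C i \<Longrightarrow> Dom C i = Cod C p \<Longrightarrow> i \<cdot> p \<in> Displays C"

locale display_functor =
  dom: display_category C + cod: display_category D + cat_functor C D F
  for C :: "('o, 'm, 'y) display_cat_scheme"
    and D :: "('p, 'n, 'z) display_cat_scheme"
    and F :: "('o, 'm, 'p, 'n) cfunctor" +
  assumes farr_Displays: "p \<in> Displays C \<Longrightarrow> farr F p \<in> Displays D"
    and farr_pullback:
      "p \<in> Displays C \<Longrightarrow> is_pullback C f p q t \<Longrightarrow>
         is_pullback D (farr F f) (farr F p) (farr F q) (farr F t)"

text \<open>The map into \<open>f\<^sup>*E\<close> with components \<open>x\<close> to \<open>A\<close> and \<open>y\<close> to \<open>E\<close>.\<close>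

definition pb_induced ::
  "('o, 'm, 'z) display_cat_scheme \<Rightarrow> 'm \<Rightarrow> 'm \<Rightarrow> 'm \<Rightarrow> 'm \<Rightarrow> 'm" where
  "pb_induced C f p x y =
     (THE h. h \<in> hom C (Dom C x) (Dom C (pb C f p)) \<and>
             pb C f p \<cdot>\<^bsub>C\<^esub> h = x \<and> pb_top C f p \<cdot>\<^bsub>C\<^esub> h = y)"

text \<open>Arrows of the categories of displays and of pointed displays are triples of source, target
  and underlying map.\<close>

type_synonym 'm disp_arr = "'m \<times> 'm \<times> 'm"
type_synonym 'm pdisp_arr = "('m \<times> 'm) \<times> ('m \<times> 'm) \<times> 'm"

definition disp_fib ::
  "('o, 'm, 'z) display_cat_scheme \<Rightarrow> 'o \<Rightarrow> ('m, 'm disp_arr) category" where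
  "disp_fib C A =
     \<lparr>Obj = {p \<in> Displays C. Cod C p = A},
      Arr = {(p, q, h). p \<in> Displays C \<and> Cod C p = A \<and> q \<in> Displays C \<and> Cod C q = A \<and>
                        h \<in> hom C (Dom C p) (Dom C q) \<and> q \<cdot>\<^bsub>C\<^esub> h = p},
      Dom = (\<lambda>(p, q, h). p),
      Cod = (\<lambda>(p, q, h). q),
      Ident = (\<lambda>p. (p, p, Ident C (Dom C p))),
      Comp = (\<lambda>(q', r, k) (p, q, h). (p, r, k \<cdot>\<^bsub>C\<^esub> h))\<rparr>"

definition disp_reind ::
  "('o, 'm, 'z) display_cat_scheme \<Rightarrow> 'm \<Rightarrow> ('m, 'm disp_arr, 'm, 'm disp_arr) cfunctor" where
  "disp_reind C u =
     \<lparr>fobj = pb C u,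
      farr = (\<lambda>(p, q, h).
        (pb C u p, pb C u q, pb_induced C u q (pb C u p) (h \<cdot>\<^bsub>C\<^esub> pb_top C u p)))\<rparr>"

definition disp_indexed ::
  "('o, 'm, 'z) display_cat_scheme \<Rightarrow> ('o, 'm, 'm, 'm disp_arr) indexed_cat" where
  "disp_indexed C = \<lparr>fib = disp_fib C, reind = disp_reind C\<rparr>"

definition is_section :: "('o, 'm, 'z) category_scheme \<Rightarrow> 'm \<Rightarrow> 'm \<Rightarrow> bool" where
  "is_section C p s \<longleftrightarrow> s \<in> hom C (Cod C p) (Dom C p) \<and> p \<cdot>\<^bsub>C\<^esub> s = Ident C (Cod C p)"

definition pdisp_fib ::
  "('o, 'm, 'z) display_cat_scheme \<Rightarrow> 'o \<Rightarrow> ('m \<times> 'm, 'm pdisp_arr) category" where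
  "pdisp_fib C A =
     \<lparr>Obj = {(p, s). p \<in> Displays C \<and> Cod C p = A \<and> is_section C p s},
      Arr = {((p, s), (q, t), h).
               is_section C p s \<and> is_section C q t \<and>
               (p, q, h) \<in> Arr (disp_fib C A) \<and> h \<cdot>\<^bsub>C\<^esub> s = t},
      Dom = (\<lambda>(x, y, h). x),
      Cod = (\<lambda>(x, y, h). y),
      Ident = (\<lambda>(p, s). ((p, s), (p, s), Ident C (Dom C p))),
      Comp = (\<lambda>(y', z, k) (x, y, h). (x, z, k \<cdot>\<^bsub>C\<^esub> h))\<rparr>"

definition pdisp_reind ::
  "('o, 'm, 'z) display_cat_scheme \<Rightarrow> 'm \<Rightarrow>
     ('m \<times> 'm, 'm pdisp_arr, 'm \<times> 'm, 'm pdisp_arr) cfunctor" where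
  "pdisp_reind C u =
     (let re = (\<lambda>(p, s). (pb C u p, pb_induced C u p (Ident C (Dom C u)) (s \<cdot>\<^bsub>C\<^esub> u)))
      in \<lparr>fobj = re,
          farr = (\<lambda>(x, y, h).
            (re x, re y, snd (snd (farr (disp_reind C u) (fst x, fst y, h)))))\<rparr>)"

definition pdisp_indexed ::
  "('o, 'm, 'z) display_cat_scheme \<Rightarrow> ('o, 'm, 'm \<times> 'm, 'm pdisp_arr) indexed_cat" where
  "pdisp_indexed C = \<lparr>fib = pdisp_fib C, reind = pdisp_reind C\<rparr>"

definition disp_nat ::
  "('o, 'm, 'y) display_cat_scheme \<Rightarrow> ('p, 'n, 'z) display_cat_scheme \<Rightarrow>
     ('o, 'm, 'p, 'n) cfunctor \<Rightarrow> ('o, 'm, 'p, 'n) cfunctor \<Rightarrow> ('o \<Rightarrow> 'n) \<Rightarrow> 'm \<Rightarrow> 'n disp_arr" where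
  "disp_nat C D F G \<alpha> p =
     (farr F p, fobj (reind (disp_indexed D) (\<alpha> (Cod C p))) (farr G p),
      pb_induced D (\<alpha> (Cod C p)) (farr G p) (farr F p) (\<alpha> (Dom C p)))"

definition pdisp_nat ::
  "('o, 'm, 'y) display_cat_scheme \<Rightarrow> ('p, 'n, 'z) display_cat_scheme \<Rightarrow>
     ('o, 'm, 'p, 'n) cfunctor \<Rightarrow> ('o, 'm, 'p, 'n) cfunctor \<Rightarrow> ('o \<Rightarrow> 'n) \<Rightarrow>
     'm \<times> 'm \<Rightarrow> 'n pdisp_arr" where
  "pdisp_nat C D F G \<alpha> = (\<lambda>(p, s).
     ((farr F p, farr F s),
      fobj (reind (pdisp_indexed D) (\<alpha> (Cod C p))) (farr G p, farr G s),
      snd (snd (disp_nat C D F G \<alpha> p))))"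


section \<open>Pre-natural models\<close>

text \<open>\<open>typeof C \<Gamma>\<close> is the component at \<open>\<Gamma>\<close> of \<open>p\<^sub>C : Tm \<rightarrow> Tp\<close>; \<open>ext C \<Gamma> A\<close> is the display
  \<open>p\<^sub>A : \<Gamma>.A \<rightarrow> \<Gamma>\<close> and \<open>var C \<Gamma> A\<close> the universal element \<open>v\<^sub>A\<close>.\<close>

record ('o, 'm, 'a, 'b, 't, 'x) pnm = "('o, 'm) display_cat" +
  Tp :: "('o, 'm, 'a, 'b) indexed_cat"
  Tm :: "('o, 'm, 't, 'x) indexed_cat"
  typeof :: "'o \<Rightarrow> ('t, 'x, 'a, 'b) cfunctor"
  ext :: "'o \<Rightarrow> 'a \<Rightarrow> 'm"
  var :: "'o \<Rightarrow> 'a \<Rightarrow> 't"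

definition ext_elements ::
  "('o, 'm, 'a, 'b, 't, 'x, 'z) pnm_scheme \<Rightarrow> 'o \<Rightarrow> 'a \<Rightarrow> 'o \<Rightarrow> ('m \<times> 't) set" where
  "ext_elements C \<Gamma> A \<Delta> =
     {(u, t). u \<in> hom C \<Delta> \<Gamma> \<and> t \<in> Obj (fib (Tm C) \<Delta>) \<and>
              fobj (typeof C \<Delta>) t = fobj (reind (Tp C) u) A}"

locale pre_natural_model = display_category C +
  ty: strict_indexed_functor C "Tm C" "Tp C" "typeof C"
  for C :: "('o, 'm, 'a, 'b, 't, 'x, 'z) pnm_scheme" (structure) +
  assumes typeof_opfibration:
      "\<Gamma> \<in> Obj C \<Longrightarrow> discrete_opfibration (fib (Tm C) \<Gamma>) (fib (Tp C) \<Gamma>) (typeof C \<Gamma>)"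
    and ext_Displays:
      "\<Gamma> \<in> Obj C \<Longrightarrow> A \<in> Obj (fib (Tp C) \<Gamma>) \<Longrightarrow> ext C \<Gamma> A \<in> Displays C \<and> Cod C (ext C \<Gamma> A) = \<Gamma>"
    and var_Obj:
      "\<Gamma> \<in> Obj C \<Longrightarrow> A \<in> Obj (fib (Tp C) \<Gamma>) \<Longrightarrow>
         var C \<Gamma> A \<in> Obj (fib (Tm C) (Dom C (ext C \<Gamma> A)))"
    and representable:
      "\<Gamma> \<in> Obj C \<Longrightarrow> A \<in> Obj (fib (Tp C) \<Gamma>) \<Longrightarrow> \<Delta> \<in> Obj C \<Longrightarrow>
         bij_betw (\<lambda>h. (ext C \<Gamma> A \<cdot> h, fobj (reind (Tm C) h) (var C \<Gamma> A)))
           (hom C \<Delta> (Dom C (ext C \<Gamma> A))) (ext_elements C \<Gamma> A \<Delta>)"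

text \<open>The map \<open>h : \<Delta> \<rightarrow> \<Gamma>.A\<close> over \<open>u : \<Delta> \<rightarrow> \<Gamma>\<close> with \<open>v\<^sub>A[h] = t\<close>.\<close>

definition ext_induced ::
  "('o, 'm, 'a, 'b, 't, 'x, 'z) pnm_scheme \<Rightarrow> 'o \<Rightarrow> 'a \<Rightarrow> 'm \<Rightarrow> 't \<Rightarrow> 'm" where
  "ext_induced C \<Gamma> A u t =
     (THE h. h \<in> hom C (Dom C u) (Dom C (ext C \<Gamma> A)) \<and>
             ext C \<Gamma> A \<cdot>\<^bsub>C\<^esub> h = u \<and> fobj (reind (Tm C) h) (var C \<Gamma> A) = t)"

definition tm_lift ::
  "('o, 'm, 'a, 'b, 't, 'x, 'z) pnm_scheme \<Rightarrow> 'o \<Rightarrow> 'b \<Rightarrow> 't \<Rightarrow> 'x" where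
  "tm_lift C \<Gamma> f t =
     (THE x. x \<in> Arr (fib (Tm C) \<Gamma>) \<and> Dom (fib (Tm C) \<Gamma>) x = t \<and> farr (typeof C \<Gamma>) x = f)"

definition ext_arr ::
  "('o, 'm, 'a, 'b, 't, 'x, 'z) pnm_scheme \<Rightarrow> 'o \<Rightarrow> 'b \<Rightarrow> 'm" where
  "ext_arr C \<Gamma> f =
     (let A = Dom (fib (Tp C) \<Gamma>) f; B = Cod (fib (Tp C) \<Gamma>) f;
          pA = ext C \<Gamma> A; \<Gamma>A = Dom C pA
      in ext_induced C \<Gamma> B pA
           (Cod (fib (Tm C) \<Gamma>A) (tm_lift C \<Gamma>A (farr (reind (Tp C) pA) f) (var C \<Gamma> A))))"

definition comprehension ::
  "('o, 'm, 'a, 'b, 't, 'x, 'z) pnm_scheme \<Rightarrow> 'o \<Rightarrow> ('a, 'b, 'm, 'm disp_arr) cfunctor" where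
  "comprehension C \<Gamma> =
     \<lparr>fobj = ext C \<Gamma>,
      farr = (\<lambda>f. (ext C \<Gamma> (Dom (fib (Tp C) \<Gamma>) f), ext C \<Gamma> (Cod (fib (Tp C) \<Gamma>) f),
                   ext_arr C \<Gamma> f))\<rparr>"

definition tm_section ::
  "('o, 'm, 'a, 'b, 't, 'x, 'z) pnm_scheme \<Rightarrow> 'o \<Rightarrow> 't \<Rightarrow> 'm" where
  "tm_section C \<Gamma> a = ext_induced C \<Gamma> (fobj (typeof C \<Gamma>) a) (Ident C \<Gamma>) a"

definition pcomprehension ::
  "('o, 'm, 'a, 'b, 't, 'x, 'z) pnm_scheme \<Rightarrow> 'o \<Rightarrow> ('t, 'x, 'm \<times> 'm, 'm pdisp_arr) cfunctor" where
  "pcomprehension C \<Gamma> =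
     (let pt = (\<lambda>a. (ext C \<Gamma> (fobj (typeof C \<Gamma>) a), tm_section C \<Gamma> a))
      in \<lparr>fobj = pt,
          farr = (\<lambda>x. (pt (Dom (fib (Tm C) \<Gamma>) x), pt (Cod (fib (Tm C) \<Gamma>) x),
                       snd (snd (farr (comprehension C \<Gamma>) (farr (typeof C \<Gamma>) x)))))\<rparr>)"

text \<open>For \<open>u : \<Delta> \<rightarrow> \<Gamma>\<close>, the square with sides \<open>p\<^bsub>A[u]\<^esub>\<close>, \<open>u\<close>, \<open>p\<^sub>A\<close> and
  \<open>ext_top C u A : \<Delta>.A[u] \<rightarrow> \<Gamma>.A\<close> is a pullback; \<open>\<rho>\<close> is the comparison map of the chosen pullback
  with this one.\<close>

definition ext_top ::
  "('o, 'm, 'a, 'b, 't, 'x, 'z) pnm_scheme \<Rightarrow> 'm \<Rightarrow> 'a \<Rightarrow> 'm" where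
  "ext_top C u A =
     (let Au = fobj (reind (Tp C) u) A
      in ext_induced C (Cod C u) A (u \<cdot>\<^bsub>C\<^esub> ext C (Dom C u) Au) (var C (Dom C u) Au))"

definition rho ::
  "('o, 'm, 'a, 'b, 't, 'x, 'z) pnm_scheme \<Rightarrow> 'm \<Rightarrow> 'a \<Rightarrow> 'm disp_arr" where
  "rho C u A =
     (let p = pb C u (ext C (Cod C u) A); q = ext C (Dom C u) (fobj (reind (Tp C) u) A)
      in (p, q,
          THE h. h \<in> hom C (Dom C p) (Dom C q) \<and> q \<cdot>\<^bsub>C\<^esub> h = p \<and>
                 ext_top C u A \<cdot>\<^bsub>C\<^esub> h = pb_top C u (ext C (Cod C u) A)))"

definition prho ::
  "('o, 'm, 'a, 'b, 't, 'x, 'z) pnm_scheme \<Rightarrow> 'm \<Rightarrow> 't \<Rightarrow> 'm pdisp_arr" where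
  "prho C u a =
     (fobj (reind (pdisp_indexed C) u) (fobj (pcomprehension C (Cod C u)) a),
      fobj (pcomprehension C (Dom C u)) (fobj (reind (Tm C) u) a),
      snd (snd (rho C u (fobj (typeof C (Cod C u)) a))))"


section \<open>Morphisms and 2-morphisms of pre-natural models\<close>

record ('o, 'm, 'a, 'b, 't, 'x, 'p, 'n, 'c, 'd, 's, 'y) pnm_mor =
  base :: "('o, 'm, 'p, 'n) cfunctor"
  mTp :: "'o \<Rightarrow> ('a, 'b, 'c, 'd) cfunctor"
  mTm :: "'o \<Rightarrow> ('t, 'x, 's, 'y) cfunctor"

locale pnm_morphism =
  dom: pre_natural_model C + cod: pre_natural_model D + base: display_functor C D "base F" +
  mTp: strict_indexed_functor C "Tp C" "change_base (base F) (Tp D)" "mTp F" +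
  mTm: strict_indexed_functor C "Tm C" "change_base (base F) (Tm D)" "mTm F"
  for C :: "('o, 'm, 'a, 'b, 't, 'x) pnm"
    and D :: "('p, 'n, 'c, 'd, 's, 'y) pnm"
    and F :: "('o, 'm, 'a, 'b, 't, 'x, 'p, 'n, 'c, 'd, 's, 'y) pnm_mor" +
  assumes typeof_obj:
      "\<Gamma> \<in> Obj C \<Longrightarrow> a \<in> Obj (fib (Tm C) \<Gamma>) \<Longrightarrow>
         fobj (typeof D (fobj (base F) \<Gamma>)) (fobj (mTm F \<Gamma>) a) =
         fobj (mTp F \<Gamma>) (fobj (typeof C \<Gamma>) a)"
    and typeof_arr:
      "\<Gamma> \<in> Obj C \<Longrightarrow> x \<in> Arr (fib (Tm C) \<Gamma>) \<Longrightarrow>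
         farr (typeof D (fobj (base F) \<Gamma>)) (farr (mTm F \<Gamma>) x) =
         farr (mTp F \<Gamma>) (farr (typeof C \<Gamma>) x)"

definition tau ::
  "('o, 'm, 'a, 'b, 't, 'x) pnm \<Rightarrow> ('p, 'n, 'c, 'd, 's, 'y) pnm \<Rightarrow>
     ('o, 'm, 'a, 'b, 't, 'x, 'p, 'n, 'c, 'd, 's, 'y) pnm_mor \<Rightarrow> 'o \<Rightarrow> 'a \<Rightarrow> 'n disp_arr" where
  "tau C D F \<Gamma> A =
     (let FG = fobj (base F) \<Gamma>; FA = fobj (mTp F \<Gamma>) A;
          FpA = farr (base F) (ext C \<Gamma> A)
      in (FpA, ext D FG FA,
          ext_induced D FG FA FpA (fobj (mTm F (Dom C (ext C \<Gamma> A))) (var C \<Gamma> A))))"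

definition ptau ::
  "('o, 'm, 'a, 'b, 't, 'x) pnm \<Rightarrow> ('p, 'n, 'c, 'd, 's, 'y) pnm \<Rightarrow>
     ('o, 'm, 'a, 'b, 't, 'x, 'p, 'n, 'c, 'd, 's, 'y) pnm_mor \<Rightarrow> 'o \<Rightarrow> 't \<Rightarrow> 'n pdisp_arr" where
  "ptau C D F \<Gamma> a =
     (let A = fobj (typeof C \<Gamma>) a
      in ((farr (base F) (ext C \<Gamma> A), farr (base F) (tm_section C \<Gamma> a)),
          fobj (pcomprehension D (fobj (base F) \<Gamma>)) (fobj (mTm F \<Gamma>) a),
          snd (snd (tau C D F \<Gamma> A))))"

record ('o, 'a, 't, 'n, 'd, 'y) pnm_2mor =
  nt :: "'o \<Rightarrow> 'n"
  nTp :: "'o \<Rightarrow> 'a \<Rightarrow> 'd"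
  nTm :: "'o \<Rightarrow> 't \<Rightarrow> 'y"

locale pnm_2morphism =
  src: pnm_morphism C D F + trg: pnm_morphism C D G +
  nt: nat_trans C D "base F" "base G" "nt \<alpha>" +
  nTp: indexed_nat_trans C "Tp C" "change_base (base F) (Tp D)" "mTp F"
    "\<lambda>\<Gamma>. change_base_nat (nt \<alpha>) (Tp D) \<Gamma> \<circ>\<^sub>F mTp G \<Gamma>" "nTp \<alpha>" +
  nTm: indexed_nat_trans C "Tm C" "change_base (base F) (Tm D)" "mTm F"
    "\<lambda>\<Gamma>. change_base_nat (nt \<alpha>) (Tm D) \<Gamma> \<circ>\<^sub>F mTm G \<Gamma>" "nTm \<alpha>"
  for C :: "('o, 'm, 'a, 'b, 't, 'x) pnm"
    and D :: "('p, 'n, 'c, 'd, 's, 'y) pnm"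
    and F G :: "('o, 'm, 'a, 'b, 't, 'x, 'p, 'n, 'c, 'd, 's, 'y) pnm_mor"
    and \<alpha> :: "('o, 'a, 't, 'n, 'd, 'y) pnm_2mor" +
  assumes typeof_component:
    "\<Gamma> \<in> Obj C \<Longrightarrow> a \<in> Obj (fib (Tm C) \<Gamma>) \<Longrightarrow>
       farr (typeof D (fobj (base F) \<Gamma>)) (nTm \<alpha> \<Gamma> a) = nTp \<alpha> \<Gamma> (fobj (typeof C \<Gamma>) a)"

end

theory Submission
  imports Defs
begin

text \<open>
  A map into a context extension \<open>\<Gamma>.B\<close> is determined by its composite with \<open>p\<^sub>B\<close> and by the
  pullback of \<open>v\<^sub>B\<close> along it. Both maps in (1) lie over \<open>F p\<^sub>A\<close>, and both pull the universal element
  back to \<open>(G v\<^sub>A)[\<alpha>\<^bsub>\<Gamma>.A\<^esub>]\<close>: for the right-hand side this is a direct computation, and for the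
  left-hand side the term \<open>\<alpha>\<^bsub>v\<^sub>A\<^esub> : F v\<^sub>A \<rightarrow> (G v\<^sub>A)[\<alpha>\<^bsub>\<Gamma>.A\<^esub>]\<close> lies over \<open>\<alpha>\<^bsub>A[p\<^sub>A]\<^esub> = \<alpha>\<^sub>A[F p\<^sub>A]\<close>, so
  it is the unique lift by which \<open>comp(\<alpha>\<^sub>A)\<close> is defined. In (2) the underlying maps are those of (1).
\<close>

section \<open>Hom-sets, chosen pullbacks and strict reindexing\<close>

lemma hom_Dom_Cod: "f \<in> hom C a b \<Longrightarrow> Dom C f = a" "f \<in> hom C a b \<Longrightarrow> Cod C f = b"
  by (auto simp: hom_def)

lemma (in category) hom_Obj: "f \<in> hom C a b \<Longrightarrow> a \<in> Obj C \<and> b \<in> Obj C"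
  using Dom_Obj Cod_Obj by (auto simp: hom_def)

context display_category
begin

lemma display_hom: "p \<in> Displays C \<Longrightarrow> p \<in> hom C (Dom C p) (Cod C p)"
  using Displays_Arr by (auto simp: hom_def)

lemma pb_square:
  assumes "p \<in> Displays C" "Cod C p = B" "f \<in> hom C A B"
  shows "pb C f p \<in> hom C (Dom C (pb C f p)) A"
    and "pb_top C f p \<in> hom C (Dom C (pb C f p)) (Dom C p)"
    and "p \<cdot> pb_top C f p = f \<cdot> pb C f p"
  using pb_is_pullback[of p f] assms by (auto simp: is_pullback_def hom_def)

text \<open>Compatibility of \<open>x\<close> and \<open>y\<close> brings the universal property in
  \<open>is_pullback\<close> to bear, so the definite description \<open>pb_induced\<close>
  denotes.\<close>

lemma pb_induced:
  assumes p: "p \<in> Displays C" "Cod C p = B" and f: "f \<in> hom C A B"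
    and x: "x \<in> hom C X A" and y: "y \<in> hom C X (Dom C p)" and eq: "p \<cdot> y = f \<cdot> x"
  shows "pb_induced C f p x y \<in> hom C X (Dom C (pb C f p))"
    and "pb C f p \<cdot> pb_induced C f p x y = x"
    and "pb_top C f p \<cdot> pb_induced C f p x y = y"
proof -
  have D: "Dom C x = X" "Dom C f = A" and X: "X \<in> Obj C"
    using x f hom_Obj by (auto simp: hom_def)
  have "is_pullback C f p (pb C f p) (pb_top C f p)"
    using pb_is_pullback[of p f] p f by (auto simp: hom_def)
  then have "\<exists>!h. h \<in> hom C X (Dom C (pb C f p)) \<and> pb C f p \<cdot> h = x \<and> pb_top C f p \<cdot> h = y"
    using X x y eq unfolding is_pullback_def D by blast
  from theI'[OF this]
  show "pb_induced C f p x y \<in> hom C X (Dom C (pb C f p))"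
    and "pb C f p \<cdot> pb_induced C f p x y = x"
    and "pb_top C f p \<cdot> pb_induced C f p x y = y"
    unfolding pb_induced_def D by auto
qed

end

context strict_indexed_cat
begin

lemma reind_Obj: "u \<in> hom C \<Delta> \<Gamma> \<Longrightarrow> A \<in> Obj (fib I \<Gamma>) \<Longrightarrow> fobj (reind I u) A \<in> Obj (fib I \<Delta>)"
  using reind_functor by (blast dest: cat_functor.fobj_Obj)

lemma reind_hom:
  "u \<in> hom C \<Delta> \<Gamma> \<Longrightarrow> f \<in> hom (fib I \<Gamma>) A B \<Longrightarrow>
    farr (reind I u) f \<in> hom (fib I \<Delta>) (fobj (reind I u) A) (fobj (reind I u) B)"
  using reind_functor by (blast dest: cat_functor.farr_hom)

end

section \<open>Context extensions as representing objects\<close>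

context pre_natural_model
begin

lemma ext_hom:
  assumes "\<Gamma> \<in> Obj C" "A \<in> Obj (fib (Tp C) \<Gamma>)"
  shows "ext C \<Gamma> A \<in> hom C (Dom C (ext C \<Gamma> A)) \<Gamma>"
  using ext_Displays[OF assms] display_hom by metis

lemma ext_elements_iff:
  "(u, t) \<in> ext_elements C \<Gamma> A \<Delta> \<longleftrightarrow> u \<in> hom C \<Delta> \<Gamma> \<and> t \<in> Obj (fib (Tm C) \<Delta>) \<and>
    fobj (typeof C \<Delta>) t = fobj (reind (Tp C) u) A"
  by (simp add: ext_elements_def)

lemma typeof_Obj:
  "\<Gamma> \<in> Obj C \<Longrightarrow> a \<in> Obj (fib (Tm C) \<Gamma>) \<Longrightarrow> fobj (typeof C \<Gamma>) a \<in> Obj (fib (Tp C) \<Gamma>)"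
  using ty.component_functor by (blast dest: cat_functor.fobj_Obj)

lemma typeof_hom:
  "\<Gamma> \<in> Obj C \<Longrightarrow> x \<in> hom (fib (Tm C) \<Gamma>) a b \<Longrightarrow>
    farr (typeof C \<Gamma>) x \<in> hom (fib (Tp C) \<Gamma>) (fobj (typeof C \<Gamma>) a) (fobj (typeof C \<Gamma>) b)"
  using ty.component_functor by (blast dest: cat_functor.farr_hom)

text \<open>Representability at the identity of \<open>\<Gamma>.A\<close>.\<close>

lemma var_ext_elements:
  assumes G: "\<Gamma> \<in> Obj C" and A: "A \<in> Obj (fib (Tp C) \<Gamma>)"
  shows "(ext C \<Gamma> A, var C \<Gamma> A) \<in> ext_elements C \<Gamma> A (Dom C (ext C \<Gamma> A))"
proof -
  have p: "ext C \<Gamma> A \<in> hom C (Dom C (ext C \<Gamma> A)) \<Gamma>" by (rule ext_hom[OF G A])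
  then have O: "Dom C (ext C \<Gamma> A) \<in> Obj C" using hom_Obj by blast
  have "(ext C \<Gamma> A \<cdot> Ident C (Dom C (ext C \<Gamma> A)),
      fobj (reind (Tm C) (Ident C (Dom C (ext C \<Gamma> A)))) (var C \<Gamma> A))
    \<in> ext_elements C \<Gamma> A (Dom C (ext C \<Gamma> A))"
    using representable[OF G A O] Ident_hom[OF O] by (auto dest: bij_betwE)
  then show ?thesis
    using Comp_Ident_right[OF p] ty.dom.reind_Ident_obj[OF O var_Obj[OF G A]] by simp
qed

lemma typeof_var:
  assumes "\<Gamma> \<in> Obj C" "A \<in> Obj (fib (Tp C) \<Gamma>)"
  shows "fobj (typeof C (Dom C (ext C \<Gamma> A))) (var C \<Gamma> A) = fobj (reind (Tp C) (ext C \<Gamma> A)) A"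
  using var_ext_elements[OF assms] by (simp add: ext_elements_iff)

text \<open>The injective half of \<open>representable\<close>; it is the test by which maps into a
  context extension are compared below.\<close>

lemma ext_eqI:
  assumes G: "\<Gamma> \<in> Obj C" and A: "A \<in> Obj (fib (Tp C) \<Gamma>)"
    and h: "h \<in> hom C \<Delta> (Dom C (ext C \<Gamma> A))" and k: "k \<in> hom C \<Delta> (Dom C (ext C \<Gamma> A))"
    and "ext C \<Gamma> A \<cdot> h = ext C \<Gamma> A \<cdot> k"
    and "fobj (reind (Tm C) h) (var C \<Gamma> A) = fobj (reind (Tm C) k) (var C \<Gamma> A)"
  shows "h = k"
proof -
  have "\<Delta> \<in> Obj C" using h hom_Obj by blast
  from bij_betw_imp_inj_on[OF representable[OF G A this]] show ?thesis
    using h k assms(5,6) by (auto dest: inj_onD)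
qed

text \<open>The surjective half of \<open>representable\<close> supplies a map and
  \<open>ext_eqI\<close> makes it unique, so the definite description denotes.\<close>

lemma ext_induced:
  assumes G: "\<Gamma> \<in> Obj C" and A: "A \<in> Obj (fib (Tp C) \<Gamma>)" and ut: "(u, t) \<in> ext_elements C \<Gamma> A \<Delta>"
  shows "ext_induced C \<Gamma> A u t \<in> hom C \<Delta> (Dom C (ext C \<Gamma> A))"
    and "ext C \<Gamma> A \<cdot> ext_induced C \<Gamma> A u t = u"
    and "fobj (reind (Tm C) (ext_induced C \<Gamma> A u t)) (var C \<Gamma> A) = t"
proof -
  have u: "u \<in> hom C \<Delta> \<Gamma>" using ut by (simp add: ext_elements_iff)
  then have D: "\<Delta> \<in> Obj C" and Du: "Dom C u = \<Delta>"
    using hom_Obj by (auto simp: hom_def)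
  obtain h where h: "h \<in> hom C \<Delta> (Dom C (ext C \<Gamma> A))" "ext C \<Gamma> A \<cdot> h = u"
      "fobj (reind (Tm C) h) (var C \<Gamma> A) = t"
    using ut unfolding bij_betw_imp_surj_on[OF representable[OF G A D], symmetric] by auto
  have "ext_induced C \<Gamma> A u t = h"
    unfolding ext_induced_def Du
  proof (rule the_equality)
    show "k = h" if "k \<in> hom C \<Delta> (Dom C (ext C \<Gamma> A)) \<and> ext C \<Gamma> A \<cdot> k = u \<and>
        fobj (reind (Tm C) k) (var C \<Gamma> A) = t" for k
      using that h by (intro ext_eqI[OF G A, of k \<Delta> h]) simp_all
  qed (use h in blast)
  with h show "ext_induced C \<Gamma> A u t \<in> hom C \<Delta> (Dom C (ext C \<Gamma> A))"
    "ext C \<Gamma> A \<cdot> ext_induced C \<Gamma> A u t = u"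
    "fobj (reind (Tm C) (ext_induced C \<Gamma> A u t)) (var C \<Gamma> A) = t"
    by simp_all
qed

section \<open>Unique lifts of type morphisms, and comprehension of a type morphism\<close>

lemma tm_lift:
  assumes "\<Gamma> \<in> Obj C" "t \<in> Obj (fib (Tm C) \<Gamma>)" "f \<in> hom (fib (Tp C) \<Gamma>) (fobj (typeof C \<Gamma>) t) B"
  shows "tm_lift C \<Gamma> f t \<in> hom (fib (Tm C) \<Gamma>) t (Cod (fib (Tm C) \<Gamma>) (tm_lift C \<Gamma> f t))"
    and "farr (typeof C \<Gamma>) (tm_lift C \<Gamma> f t) = f"
proof -
  have "\<exists>!x. x \<in> Arr (fib (Tm C) \<Gamma>) \<and> Dom (fib (Tm C) \<Gamma>) x = t \<and> farr (typeof C \<Gamma>) x = f"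
    using discrete_opfibration.unique_lift[OF typeof_opfibration] assms by (auto simp: hom_def)
  from theI'[OF this]
  show "tm_lift C \<Gamma> f t \<in> hom (fib (Tm C) \<Gamma>) t (Cod (fib (Tm C) \<Gamma>) (tm_lift C \<Gamma> f t))"
    and "farr (typeof C \<Gamma>) (tm_lift C \<Gamma> f t) = f"
    by (auto simp: tm_lift_def hom_def)
qed

text \<open>In a discrete opfibration a lift is fixed by its domain and its image. The codomains
  \<open>b\<close> and \<open>c\<close> are kept apart because the lemma serves to identify the
  codomains of lifts obtained in two ways.\<close>

lemma lift_unique:
  assumes "\<Gamma> \<in> Obj C" "x \<in> hom (fib (Tm C) \<Gamma>) t b" "y \<in> hom (fib (Tm C) \<Gamma>) t c"
    and "farr (typeof C \<Gamma>) x = farr (typeof C \<Gamma>) y"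
  shows "x = y"
proof -
  interpret T: category "fib (Tm C) \<Gamma>" by (rule ty.dom.fib_category[OF assms(1)])
  have t: "t \<in> Obj (fib (Tm C) \<Gamma>)" using T.hom_Obj[OF assms(2)] ..
  have "farr (typeof C \<Gamma>) x \<in> Arr (fib (Tp C) \<Gamma>)"
    "Dom (fib (Tp C) \<Gamma>) (farr (typeof C \<Gamma>) x) = fobj (typeof C \<Gamma>) t"
    using typeof_hom[OF assms(1,2)] by (auto simp: hom_def)
  from discrete_opfibration.unique_lift[OF typeof_opfibration[OF assms(1)] t this]
  show ?thesis using assms by (auto simp: hom_def)
qed

text \<open>The lift of \<open>f[p_A]\<close> that defines \<open>ext_arr\<close> starts at
  \<open>v_A\<close>, which has type \<open>A[p_A]\<close>, and so ends at a term of type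
  \<open>B[p_A]\<close>. Paired with \<open>p_A\<close>, that term is an element of the presheaf
  represented by the extension by \<open>B\<close>, and \<open>ext_induced\<close> applies.\<close>

lemma
  assumes G: "\<Gamma> \<in> Obj C" and f: "f \<in> hom (fib (Tp C) \<Gamma>) A B"
  shows ext_arr_hom: "ext_arr C \<Gamma> f \<in> hom C (Dom C (ext C \<Gamma> A)) (Dom C (ext C \<Gamma> B))"
    and ext_ext_arr: "ext C \<Gamma> B \<cdot> ext_arr C \<Gamma> f = ext C \<Gamma> A"
    and var_ext_arr: "fobj (reind (Tm C) (ext_arr C \<Gamma> f)) (var C \<Gamma> B) =
      Cod (fib (Tm C) (Dom C (ext C \<Gamma> A)))
        (tm_lift C (Dom C (ext C \<Gamma> A)) (farr (reind (Tp C) (ext C \<Gamma> A)) f) (var C \<Gamma> A))"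
proof -
  interpret T: category "fib (Tp C) \<Gamma>" by (rule ty.cod.fib_category[OF G])
  have A: "A \<in> Obj (fib (Tp C) \<Gamma>)" and B: "B \<in> Obj (fib (Tp C) \<Gamma>)"
    using T.hom_Obj[OF f] by auto
  define p where "p = ext C \<Gamma> A"
  define E where "E = Dom C p"
  define x where "x = tm_lift C E (farr (reind (Tp C) p) f) (var C \<Gamma> A)"
  have p: "p \<in> hom C E \<Gamma>" unfolding p_def E_def by (rule ext_hom[OF G A])
  then have E: "E \<in> Obj C" using hom_Obj by blast
  have v: "var C \<Gamma> A \<in> Obj (fib (Tm C) E)" unfolding p_def E_def by (rule var_Obj[OF G A])
  have fp: "farr (reind (Tp C) p) f
      \<in> hom (fib (Tp C) E) (fobj (typeof C E) (var C \<Gamma> A)) (fobj (reind (Tp C) p) B)"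
    using ty.cod.reind_hom[OF p f] typeof_var[OF G A] by (simp add: p_def E_def)
  note x = tm_lift[OF E v fp, folded x_def]
  interpret TE: category "fib (Tm C) E" by (rule ty.dom.fib_category[OF E])
  have "fobj (typeof C E) (Cod (fib (Tm C) E) x) = fobj (reind (Tp C) p) B"
    using typeof_hom[OF E x(1)] fp x(2) by (simp add: hom_def)
  then have "(p, Cod (fib (Tm C) E) x) \<in> ext_elements C \<Gamma> B E"
    using p TE.hom_Obj[OF x(1)] by (simp add: ext_elements_iff)
  from ext_induced[OF G B this]
  have "ext_induced C \<Gamma> B p (Cod (fib (Tm C) E) x) \<in> hom C E (Dom C (ext C \<Gamma> B))"
    "ext C \<Gamma> B \<cdot> ext_induced C \<Gamma> B p (Cod (fib (Tm C) E) x) = p"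
    "fobj (reind (Tm C) (ext_induced C \<Gamma> B p (Cod (fib (Tm C) E) x))) (var C \<Gamma> B)
      = Cod (fib (Tm C) E) x" .
  moreover have "ext_arr C \<Gamma> f = ext_induced C \<Gamma> B p (Cod (fib (Tm C) E) x)"
    using f by (simp add: ext_arr_def Let_def hom_def x_def E_def p_def)
  ultimately show
    "ext_arr C \<Gamma> f \<in> hom C (Dom C (ext C \<Gamma> A)) (Dom C (ext C \<Gamma> B))"
    "ext C \<Gamma> B \<cdot> ext_arr C \<Gamma> f = ext C \<Gamma> A"
    "fobj (reind (Tm C) (ext_arr C \<Gamma> f)) (var C \<Gamma> B) =
      Cod (fib (Tm C) (Dom C (ext C \<Gamma> A)))
        (tm_lift C (Dom C (ext C \<Gamma> A)) (farr (reind (Tp C) (ext C \<Gamma> A)) f) (var C \<Gamma> A))"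
    by (simp_all add: x_def E_def p_def)
qed

text \<open>Reindexing the defining lift of \<open>ext_arr\<close> along \<open>h\<close> gives a
  lift of \<open>f[p_A h]\<close> at \<open>v_A[h]\<close>. Uniqueness identifies it with
  \<open>x\<close>, so the pulled back universal element can be read off as the codomain of any
  convenient term morphism over the right type morphism.\<close>

lemma var_ext_arr_comp:
  assumes G: "\<Gamma> \<in> Obj C" and f: "f \<in> hom (fib (Tp C) \<Gamma>) A B"
    and h: "h \<in> hom C \<Delta> (Dom C (ext C \<Gamma> A))"
    and x: "x \<in> hom (fib (Tm C) \<Delta>) (fobj (reind (Tm C) h) (var C \<Gamma> A)) b"
    and over: "farr (typeof C \<Delta>) x = farr (reind (Tp C) (ext C \<Gamma> A \<cdot> h)) f"
  shows "fobj (reind (Tm C) (ext_arr C \<Gamma> f \<cdot> h)) (var C \<Gamma> B) = b"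
proof -
  interpret T: category "fib (Tp C) \<Gamma>" by (rule ty.cod.fib_category[OF G])
  have A: "A \<in> Obj (fib (Tp C) \<Gamma>)" and B: "B \<in> Obj (fib (Tp C) \<Gamma>)"
    using T.hom_Obj[OF f] by auto
  define E where "E = Dom C (ext C \<Gamma> A)"
  define y where "y = tm_lift C E (farr (reind (Tp C) (ext C \<Gamma> A)) f) (var C \<Gamma> A)"
  have p: "ext C \<Gamma> A \<in> hom C E \<Gamma>" unfolding E_def by (rule ext_hom[OF G A])
  then have E: "E \<in> Obj C" using hom_Obj by blast
  have D: "\<Delta> \<in> Obj C" using h hom_Obj by blast
  have h': "h \<in> hom C \<Delta> E" using h by (simp add: E_def)
  have v: "var C \<Gamma> A \<in> Obj (fib (Tm C) E)" unfolding E_def by (rule var_Obj[OF G A])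
  have fp: "farr (reind (Tp C) (ext C \<Gamma> A)) f
      \<in> hom (fib (Tp C) E) (fobj (typeof C E) (var C \<Gamma> A)) (fobj (reind (Tp C) (ext C \<Gamma> A)) B)"
    using ty.cod.reind_hom[OF p f] typeof_var[OF G A] by (simp add: E_def)
  note y = tm_lift[OF E v fp, folded y_def]
  note yh = ty.dom.reind_hom[OF h' y(1)]
  have "farr (typeof C \<Delta>) (farr (reind (Tm C) h) y)
      = farr (reind (Tp C) h) (farr (reind (Tp C) (ext C \<Gamma> A)) f)"
    using ty.strict_nat_arr[OF h'] y by (simp add: hom_def)
  \<comment> \<open>Strictness: reindexing along \<open>p_A\<close> and then along \<open>h\<close>
    equals reindexing along the composite, with no coherence isomorphism.\<close>
  also have "\<dots> = farr (typeof C \<Delta>) x"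
    using ty.cod.reind_Comp_arr[OF h' p] f over by (simp add: hom_def)
  finally have "farr (reind (Tm C) h) y = x"
    using lift_unique[OF D yh x] by simp
  then have "b = fobj (reind (Tm C) h) (Cod (fib (Tm C) E) y)"
    using yh x by (simp add: hom_def)
  also have "\<dots> = fobj (reind (Tm C) h) (fobj (reind (Tm C) (ext_arr C \<Gamma> f)) (var C \<Gamma> B))"
    using var_ext_arr[OF G f] by (simp add: y_def E_def)
  also have "\<dots> = fobj (reind (Tm C) (ext_arr C \<Gamma> f \<cdot> h)) (var C \<Gamma> B)"
    using ty.dom.reind_Comp_obj[OF h ext_arr_hom[OF G f] var_Obj[OF G B]] by simp
  finally show ?thesis by simp
qed

section \<open>Terms as sections of context extensions\<close>

lemma
  assumes G: "\<Gamma> \<in> Obj C" and a: "a \<in> Obj (fib (Tm C) \<Gamma>)"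
  shows tm_section_hom: "tm_section C \<Gamma> a \<in> hom C \<Gamma> (Dom C (ext C \<Gamma> (fobj (typeof C \<Gamma>) a)))"
    and ext_tm_section: "ext C \<Gamma> (fobj (typeof C \<Gamma>) a) \<cdot> tm_section C \<Gamma> a = Ident C \<Gamma>"
    and var_tm_section:
      "fobj (reind (Tm C) (tm_section C \<Gamma> a)) (var C \<Gamma> (fobj (typeof C \<Gamma>) a)) = a"
proof -
  \<comment> \<open>The type condition on this pair is that the type of \<open>a\<close> equals its
    own reindexing along the identity, which holds by strictness.\<close>
  have "(Ident C \<Gamma>, a) \<in> ext_elements C \<Gamma> (fobj (typeof C \<Gamma>) a) \<Gamma>"
    using G a Ident_hom ty.cod.reind_Ident_obj[OF G typeof_Obj[OF G a]]
    by (simp add: ext_elements_iff)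
  note e = ext_induced[OF G typeof_Obj[OF G a] this, folded tm_section_def]
  show "tm_section C \<Gamma> a \<in> hom C \<Gamma> (Dom C (ext C \<Gamma> (fobj (typeof C \<Gamma>) a)))"
    and "ext C \<Gamma> (fobj (typeof C \<Gamma>) a) \<cdot> tm_section C \<Gamma> a = Ident C \<Gamma>"
    and "fobj (reind (Tm C) (tm_section C \<Gamma> a)) (var C \<Gamma> (fobj (typeof C \<Gamma>) a)) = a"
    by (rule e)+
qed

lemma is_section_tm_section:
  assumes "\<Gamma> \<in> Obj C" "a \<in> Obj (fib (Tm C) \<Gamma>)"
  shows "is_section C (ext C \<Gamma> (fobj (typeof C \<Gamma>) a)) (tm_section C \<Gamma> a)"
  using tm_section_hom[OF assms] ext_tm_section[OF assms]
    ext_Displays[OF assms(1) typeof_Obj[OF assms]]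
  by (simp add: is_section_def)

text \<open>Both maps lie over the identity of \<Gamma> and both pull the universal element back to
  \<open>b\<close>. On the left, \<open>v_A\<close> becomes \<open>a\<close> along the section, and
  \<open>x\<close> is itself the lift that \<open>var_ext_arr_comp\<close> asks for. This is why
  \<open>pcomprehension\<close> sends term morphisms to arrows of pointed displays.\<close>

lemma ext_arr_tm_section:
  assumes G: "\<Gamma> \<in> Obj C" and x: "x \<in> hom (fib (Tm C) \<Gamma>) a b"
  shows "ext_arr C \<Gamma> (farr (typeof C \<Gamma>) x) \<cdot> tm_section C \<Gamma> a = tm_section C \<Gamma> b"
proof -
  interpret T: category "fib (Tm C) \<Gamma>" by (rule ty.dom.fib_category[OF G])
  have a: "a \<in> Obj (fib (Tm C) \<Gamma>)" and b: "b \<in> Obj (fib (Tm C) \<Gamma>)"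
    using T.hom_Obj[OF x] by auto
  note f = typeof_hom[OF G x]
  note sa = tm_section_hom[OF G a] and sb = tm_section_hom[OF G b]
  note A = typeof_Obj[OF G a] and B = typeof_Obj[OF G b]
  show ?thesis
  proof (rule ext_eqI[OF G B Comp_hom[OF sa ext_arr_hom[OF G f]] sb])
    show "ext C \<Gamma> (fobj (typeof C \<Gamma>) b) \<cdot> ext_arr C \<Gamma> (farr (typeof C \<Gamma>) x) \<cdot> tm_section C \<Gamma> a
        = ext C \<Gamma> (fobj (typeof C \<Gamma>) b) \<cdot> tm_section C \<Gamma> b"
      using Comp_assoc[OF sa ext_arr_hom[OF G f] ext_hom[OF G B]]
      by (simp add: ext_ext_arr[OF G f] ext_tm_section G a b)
    have "fobj (reind (Tm C) (ext_arr C \<Gamma> (farr (typeof C \<Gamma>) x) \<cdot> tm_section C \<Gamma> a))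
        (var C \<Gamma> (fobj (typeof C \<Gamma>) b)) = b"
    proof (rule var_ext_arr_comp[OF G f sa])
      show "x \<in> hom (fib (Tm C) \<Gamma>)
          (fobj (reind (Tm C) (tm_section C \<Gamma> a)) (var C \<Gamma> (fobj (typeof C \<Gamma>) a))) b"
        using x var_tm_section[OF G a] by simp
      show "farr (typeof C \<Gamma>) x = farr (reind (Tp C)
          (ext C \<Gamma> (fobj (typeof C \<Gamma>) a) \<cdot> tm_section C \<Gamma> a)) (farr (typeof C \<Gamma>) x)"
        using ty.cod.reind_Ident_arr[OF G] f ext_tm_section[OF G a] by (simp add: hom_def)
    qed
    then show "fobj (reind (Tm C) (ext_arr C \<Gamma> (farr (typeof C \<Gamma>) x) \<cdot> tm_section C \<Gamma> a))
        (var C \<Gamma> (fobj (typeof C \<Gamma>) b))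
        = fobj (reind (Tm C) (tm_section C \<Gamma> b)) (var C \<Gamma> (fobj (typeof C \<Gamma>) b))"
      using var_tm_section[OF G b] by simp
  qed
qed

section \<open>Pullback squares of context extensions and the comparison \<open>rho\<close>\<close>

lemma
  assumes u: "u \<in> hom C \<Delta> \<Gamma>" and A: "A \<in> Obj (fib (Tp C) \<Gamma>)"
  shows ext_top_hom: "ext_top C u A \<in> hom C (Dom C (ext C \<Delta> (fobj (reind (Tp C) u) A)))
      (Dom C (ext C \<Gamma> A))"
    and ext_ext_top: "ext C \<Gamma> A \<cdot> ext_top C u A = u \<cdot> ext C \<Delta> (fobj (reind (Tp C) u) A)"
    and var_ext_top: "fobj (reind (Tm C) (ext_top C u A)) (var C \<Gamma> A)
      = var C \<Delta> (fobj (reind (Tp C) u) A)"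
proof -
  have G: "\<Gamma> \<in> Obj C" and D: "\<Delta> \<in> Obj C" using u hom_Obj by auto
  define Au where "Au = fobj (reind (Tp C) u) A"
  have Au: "Au \<in> Obj (fib (Tp C) \<Delta>)" unfolding Au_def by (rule ty.cod.reind_Obj[OF u A])
  note q = ext_hom[OF D Au]
  \<comment> \<open>The universal element over \<open>A[u]\<close> has type \<open>A[u]\<close>
    reindexed along its display, which strictness turns into \<open>A\<close> reindexed along the
    composite with \<open>u\<close>.\<close>
  have "(u \<cdot> ext C \<Delta> Au, var C \<Delta> Au) \<in> ext_elements C \<Gamma> A (Dom C (ext C \<Delta> Au))"
    using Comp_hom[OF q u] var_Obj[OF D Au] typeof_var[OF D Au] ty.cod.reind_Comp_obj[OF q u A]
    by (simp add: ext_elements_iff Au_def)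
  note e = ext_induced[OF G A this]
  have t: "ext_top C u A = ext_induced C \<Gamma> A (u \<cdot> ext C \<Delta> Au) (var C \<Delta> Au)"
    using u by (simp add: ext_top_def Let_def hom_def Au_def)
  show "ext_top C u A \<in> hom C (Dom C (ext C \<Delta> (fobj (reind (Tp C) u) A))) (Dom C (ext C \<Gamma> A))"
    and "ext C \<Gamma> A \<cdot> ext_top C u A = u \<cdot> ext C \<Delta> (fobj (reind (Tp C) u) A)"
    and "fobj (reind (Tm C) (ext_top C u A)) (var C \<Gamma> A) = var C \<Delta> (fobj (reind (Tp C) u) A)"
    using e unfolding t Au_def by auto
qed

text \<open>A compatible pair \<open>(x, y)\<close> yields the element \<open>(x, v_A[y])\<close> of
  the presheaf represented by the extension by \<open>A[u]\<close>, so representability over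
  \<Delta> provides the mediating map.\<close>

lemma ext_pullback:
  assumes u: "u \<in> hom C \<Delta> \<Gamma>" and A: "A \<in> Obj (fib (Tp C) \<Gamma>)"
    and x: "x \<in> hom C X \<Delta>" and y: "y \<in> hom C X (Dom C (ext C \<Gamma> A))"
    and eq: "ext C \<Gamma> A \<cdot> y = u \<cdot> x"
  shows "\<exists>!h. h \<in> hom C X (Dom C (ext C \<Delta> (fobj (reind (Tp C) u) A))) \<and>
    ext C \<Delta> (fobj (reind (Tp C) u) A) \<cdot> h = x \<and> ext_top C u A \<cdot> h = y"
proof -
  have G: "\<Gamma> \<in> Obj C" and D: "\<Delta> \<in> Obj C" and X: "X \<in> Obj C" using u x hom_Obj by auto
  define Au where "Au = fobj (reind (Tp C) u) A"
  have Au: "Au \<in> Obj (fib (Tp C) \<Delta>)" unfolding Au_def by (rule ty.cod.reind_Obj[OF u A])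
  note p = ext_hom[OF G A] and q = ext_hom[OF D Au]
  note t = ext_top_hom[OF u A, folded Au_def] ext_ext_top[OF u A, folded Au_def]
    var_ext_top[OF u A, folded Au_def]
  \<comment> \<open>Since \<open>v_A\<close> pulls back along \<open>ext_top\<close> to the
    universal element over \<open>A[u]\<close>, tests against the latter become tests against
    \<open>v_A\<close> after composing with \<open>ext_top\<close>.\<close>
  have var_top: "fobj (reind (Tm C) h) (var C \<Delta> Au)
      = fobj (reind (Tm C) (ext_top C u A \<cdot> h)) (var C \<Gamma> A)"
    if "h \<in> hom C X (Dom C (ext C \<Delta> Au))" for h
    using ty.dom.reind_Comp_obj[OF that t(1) var_Obj[OF G A]] t(3) by simp
  \<comment> \<open>The type of \<open>v_A[y]\<close> is
    \<open>A[p_A y] = A[u x] = A[u][x]\<close>.\<close>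
  have "fobj (typeof C X) (fobj (reind (Tm C) y) (var C \<Gamma> A)) = fobj (reind (Tp C) x) Au"
    using ty.strict_nat_obj[OF y var_Obj[OF G A]] typeof_var[OF G A]
      ty.cod.reind_Comp_obj[OF y p A] ty.cod.reind_Comp_obj[OF x u A] eq
    by (simp add: Au_def)
  then have el: "(x, fobj (reind (Tm C) y) (var C \<Gamma> A)) \<in> ext_elements C \<Delta> Au X"
    using x ty.dom.reind_Obj[OF y var_Obj[OF G A]] by (simp add: ext_elements_iff)
  note e = ext_induced[OF D Au el]
  define h where "h = ext_induced C \<Delta> Au x (fobj (reind (Tm C) y) (var C \<Gamma> A))"
  note h = e[folded h_def]
  have "ext_top C u A \<cdot> h = y"
  proof (rule ext_eqI[OF G A Comp_hom[OF h(1) t(1)] y])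
    show "ext C \<Gamma> A \<cdot> ext_top C u A \<cdot> h = ext C \<Gamma> A \<cdot> y"
      using Comp_assoc[OF h(1) t(1) p] Comp_assoc[OF h(1) q u] t(2) h(2) eq by simp
    show "fobj (reind (Tm C) (ext_top C u A \<cdot> h)) (var C \<Gamma> A) = fobj (reind (Tm C) y) (var C \<Gamma> A)"
      using var_top[OF h(1)] h(3) by simp
  qed
  moreover have "k = h" if "k \<in> hom C X (Dom C (ext C \<Delta> Au))" "ext C \<Delta> Au \<cdot> k = x"
    "ext_top C u A \<cdot> k = y" for k
    using that h var_top[OF that(1)] by (intro ext_eqI[OF D Au, of k X h]) simp_all
  ultimately show ?thesis
    unfolding Au_def[symmetric] by (intro ex1I[of _ h]) (simp_all add: h(1,2))
qed

text \<open>The chosen pullback of \<open>p_A\<close> along \<open>u\<close> is a cone for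
  \<open>ext_pullback\<close>, so the description inside \<open>rho\<close> denotes. The first claim
  exhibits \<open>rho\<close> as an explicit triple because composition in \<open>disp_fib\<close>
  matches on triples.\<close>

lemma
  assumes u: "u \<in> hom C \<Delta> \<Gamma>" and A: "A \<in> Obj (fib (Tp C) \<Gamma>)"
  shows rho_eq: "rho C u A =
      (pb C u (ext C \<Gamma> A), ext C \<Delta> (fobj (reind (Tp C) u) A), snd (snd (rho C u A)))"
    and rho_hom: "snd (snd (rho C u A))
      \<in> hom C (Dom C (pb C u (ext C \<Gamma> A))) (Dom C (ext C \<Delta> (fobj (reind (Tp C) u) A)))"
    and ext_rho: "ext C \<Delta> (fobj (reind (Tp C) u) A) \<cdot> snd (snd (rho C u A)) = pb C u (ext C \<Gamma> A)"
    and ext_top_rho: "ext_top C u A \<cdot> snd (snd (rho C u A)) = pb_top C u (ext C \<Gamma> A)"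
proof -
  have G: "\<Gamma> \<in> Obj C" using u hom_Obj by auto
  have d: "ext C \<Gamma> A \<in> Displays C" "Cod C (ext C \<Gamma> A) = \<Gamma>" using ext_Displays[OF G A] by auto
  note s = pb_square[OF d u]
  from theI'[OF ext_pullback[OF u A s(1,2,3)]]
  show "rho C u A =
      (pb C u (ext C \<Gamma> A), ext C \<Delta> (fobj (reind (Tp C) u) A), snd (snd (rho C u A)))"
    and "snd (snd (rho C u A))
      \<in> hom C (Dom C (pb C u (ext C \<Gamma> A))) (Dom C (ext C \<Delta> (fobj (reind (Tp C) u) A)))"
    and "ext C \<Delta> (fobj (reind (Tp C) u) A) \<cdot> snd (snd (rho C u A)) = pb C u (ext C \<Gamma> A)"
    and "ext_top C u A \<cdot> snd (snd (rho C u A)) = pb_top C u (ext C \<Gamma> A)"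
    using hom_Dom_Cod[OF u] by (simp_all add: rho_def Let_def)
qed

end

section \<open>Morphisms of pre-natural models and the maps \<open>tau\<close>\<close>

lemma change_base_simps [simp]:
  "fib (change_base F I) \<Gamma> = fib I (fobj F \<Gamma>)"
  "reind (change_base F I) u = reind I (farr F u)"
  by (simp_all add: change_base_def)

context pnm_morphism
begin

lemma mTp_Obj:
  "\<Gamma> \<in> Obj C \<Longrightarrow> A \<in> Obj (fib (Tp C) \<Gamma>) \<Longrightarrow>
    fobj (mTp F \<Gamma>) A \<in> Obj (fib (Tp D) (fobj (base F) \<Gamma>))"
  using mTp.component_functor[of \<Gamma>] by (auto dest: cat_functor.fobj_Obj)

lemma mTm_Obj:
  "\<Gamma> \<in> Obj C \<Longrightarrow> a \<in> Obj (fib (Tm C) \<Gamma>) \<Longrightarrow>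
    fobj (mTm F \<Gamma>) a \<in> Obj (fib (Tm D) (fobj (base F) \<Gamma>))"
  using mTm.component_functor[of \<Gamma>] by (auto dest: cat_functor.fobj_Obj)

text \<open>By strict naturality and compatibility with \<open>typeof\<close>, \<open>F v_A\<close>
  has type \<open>F(A[p_A]) = (FA)[F p_A]\<close>. So \<open>F p_A\<close> and \<open>F v_A\<close>
  form an element of the presheaf represented by the extension by \<open>FA\<close>.\<close>

lemma
  assumes G: "\<Gamma> \<in> Obj C" and A: "A \<in> Obj (fib (Tp C) \<Gamma>)"
  shows tau_eq: "tau C D F \<Gamma> A = (farr (base F) (ext C \<Gamma> A),
      ext D (fobj (base F) \<Gamma>) (fobj (mTp F \<Gamma>) A), snd (snd (tau C D F \<Gamma> A)))"
    and tau_hom: "snd (snd (tau C D F \<Gamma> A)) \<in> hom D (fobj (base F) (Dom C (ext C \<Gamma> A)))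
      (Dom D (ext D (fobj (base F) \<Gamma>) (fobj (mTp F \<Gamma>) A)))"
    and ext_tau: "ext D (fobj (base F) \<Gamma>) (fobj (mTp F \<Gamma>) A) \<cdot>\<^bsub>D\<^esub> snd (snd (tau C D F \<Gamma> A))
      = farr (base F) (ext C \<Gamma> A)"
    and var_tau: "fobj (reind (Tm D) (snd (snd (tau C D F \<Gamma> A))))
      (var D (fobj (base F) \<Gamma>) (fobj (mTp F \<Gamma>) A))
      = fobj (mTm F (Dom C (ext C \<Gamma> A))) (var C \<Gamma> A)"
proof -
  note p = dom.ext_hom[OF G A]
  have E: "Dom C (ext C \<Gamma> A) \<in> Obj C" using p dom.hom_Obj by blast
  have "(farr (base F) (ext C \<Gamma> A), fobj (mTm F (Dom C (ext C \<Gamma> A))) (var C \<Gamma> A))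
    \<in> ext_elements D (fobj (base F) \<Gamma>) (fobj (mTp F \<Gamma>) A) (fobj (base F) (Dom C (ext C \<Gamma> A)))"
    using base.farr_hom[OF p] mTm_Obj[OF E dom.var_Obj[OF G A]]
      typeof_obj[OF E dom.var_Obj[OF G A]] dom.typeof_var[OF G A] mTp.strict_nat_obj[OF p A]
    by (simp add: cod.ext_elements_iff)
  from cod.ext_induced[OF base.fobj_Obj[OF G] mTp_Obj[OF G A] this]
  show "tau C D F \<Gamma> A = (farr (base F) (ext C \<Gamma> A),
      ext D (fobj (base F) \<Gamma>) (fobj (mTp F \<Gamma>) A), snd (snd (tau C D F \<Gamma> A)))"
    and "snd (snd (tau C D F \<Gamma> A)) \<in> hom D (fobj (base F) (Dom C (ext C \<Gamma> A)))
      (Dom D (ext D (fobj (base F) \<Gamma>) (fobj (mTp F \<Gamma>) A)))"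
    and "ext D (fobj (base F) \<Gamma>) (fobj (mTp F \<Gamma>) A) \<cdot>\<^bsub>D\<^esub> snd (snd (tau C D F \<Gamma> A))
      = farr (base F) (ext C \<Gamma> A)"
    and "fobj (reind (Tm D) (snd (snd (tau C D F \<Gamma> A))))
      (var D (fobj (base F) \<Gamma>) (fobj (mTp F \<Gamma>) A))
      = fobj (mTm F (Dom C (ext C \<Gamma> A))) (var C \<Gamma> A)"
    by (simp_all add: tau_def Let_def)
qed

lemma is_section_farr:
  assumes G: "\<Gamma> \<in> Obj C" and p: "p \<in> hom C E \<Gamma>" and s: "is_section C p s"
  shows "is_section D (farr (base F) p) (farr (base F) s)"
proof -
  have D: "Dom C p = E" "Cod C p = \<Gamma>" using p by (auto simp: hom_def)
  then have s: "s \<in> hom C \<Gamma> E" "p \<cdot>\<^bsub>C\<^esub> s = Ident C \<Gamma>" using s by (auto simp: is_section_def)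
  show ?thesis
    using base.farr_hom[OF s(1)] hom_Dom_Cod[OF base.farr_hom[OF p]]
      base.farr_Comp[OF s(1) p] base.farr_Ident[OF G] s(2)
    by (simp add: is_section_def)
qed

text \<open>Both sides lie over the identity of \<open>F\<Gamma>\<close> and pull the universal
  element back to \<open>Fa\<close>; on the left this is
  \<open>(F v_A)[F s] = F(v_A[s]) = F a\<close>, with \<open>s\<close> the section of
  \<open>a\<close>. Hence \<open>ptau\<close> respects the sections.\<close>

lemma tau_tm_section:
  assumes G: "\<Gamma> \<in> Obj C" and a: "a \<in> Obj (fib (Tm C) \<Gamma>)"
  shows "snd (snd (tau C D F \<Gamma> (fobj (typeof C \<Gamma>) a))) \<cdot>\<^bsub>D\<^esub> farr (base F) (tm_section C \<Gamma> a)
    = tm_section D (fobj (base F) \<Gamma>) (fobj (mTm F \<Gamma>) a)"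
proof -
  define A where "A = fobj (typeof C \<Gamma>) a"
  define t where "t = snd (snd (tau C D F \<Gamma> A))"
  let ?Fs = "farr (base F) (tm_section C \<Gamma> a)" and ?FG = "fobj (base F) \<Gamma>"
    and ?Fa = "fobj (mTm F \<Gamma>) a" and ?FA = "fobj (mTp F \<Gamma>) A"
  have A: "A \<in> Obj (fib (Tp C) \<Gamma>)" unfolding A_def by (rule dom.typeof_Obj[OF G a])
  note FG = base.fobj_Obj[OF G] and FA = mTp_Obj[OF G A] and Fa = mTm_Obj[OF G a]
  note p = dom.ext_hom[OF G A]
  have E: "Dom C (ext C \<Gamma> A) \<in> Obj C" using p dom.hom_Obj by blast
  note v = dom.var_Obj[OF G A]
  note s = dom.tm_section_hom[OF G a, folded A_def] dom.ext_tm_section[OF G a, folded A_def]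
    dom.var_tm_section[OF G a, folded A_def]
  note Fs = base.farr_hom[OF s(1)]
  note t = tau_hom[OF G A, folded t_def] ext_tau[OF G A, folded t_def] var_tau[OF G A, folded t_def]
  have ty: "fobj (typeof D ?FG) ?Fa = ?FA" using typeof_obj[OF G a] by (simp add: A_def)
  note s' = cod.tm_section_hom[OF FG Fa, unfolded ty] cod.ext_tm_section[OF FG Fa, unfolded ty]
    cod.var_tm_section[OF FG Fa, unfolded ty]
  have "t \<cdot>\<^bsub>D\<^esub> ?Fs = tm_section D ?FG ?Fa"
  proof (rule cod.ext_eqI[OF FG FA cod.Comp_hom[OF Fs t(1)] s'(1)])
    show "ext D ?FG ?FA \<cdot>\<^bsub>D\<^esub> t \<cdot>\<^bsub>D\<^esub> ?Fs = ext D ?FG ?FA \<cdot>\<^bsub>D\<^esub> tm_section D ?FG ?Fa"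
      using cod.Comp_assoc[OF Fs t(1) cod.ext_hom[OF FG FA]] t(2) s(2) s'(2)
        base.farr_Comp[OF s(1) p] base.farr_Ident[OF G] by simp
    show "fobj (reind (Tm D) (t \<cdot>\<^bsub>D\<^esub> ?Fs)) (var D ?FG ?FA)
        = fobj (reind (Tm D) (tm_section D ?FG ?Fa)) (var D ?FG ?FA)"
      using cod.ty.dom.reind_Comp_obj[OF Fs t(1) cod.var_Obj[OF FG FA]] t(3) s'(3) s(3)
        mTm.strict_nat_obj[OF s(1) v] by simp
  qed
  then show ?thesis by (simp add: t_def A_def)
qed

end

section \<open>Components of a 2-morphism and the two composites of (1)\<close>

context pnm_2morphism
begin

lemma nTp_hom:
  "\<Gamma> \<in> Obj C \<Longrightarrow> A \<in> Obj (fib (Tp C) \<Gamma>) \<Longrightarrow> nTp \<alpha> \<Gamma> A \<in> hom (fib (Tp D) (fobj (base F) \<Gamma>))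
    (fobj (mTp F \<Gamma>) A) (fobj (reind (Tp D) (nt \<alpha> \<Gamma>)) (fobj (mTp G \<Gamma>) A))"
  using nat_trans.component_hom[OF nTp.component_nat_trans, of \<Gamma> A]
  by (simp add: cfunctor_comp_def change_base_nat_def)

lemma nTm_hom:
  "\<Gamma> \<in> Obj C \<Longrightarrow> a \<in> Obj (fib (Tm C) \<Gamma>) \<Longrightarrow> nTm \<alpha> \<Gamma> a \<in> hom (fib (Tm D) (fobj (base F) \<Gamma>))
    (fobj (mTm F \<Gamma>) a) (fobj (reind (Tm D) (nt \<alpha> \<Gamma>)) (fobj (mTm G \<Gamma>) a))"
  using nat_trans.component_hom[OF nTm.component_nat_trans, of \<Gamma> a]
  by (simp add: cfunctor_comp_def change_base_nat_def)

text \<open>These are the data that \<open>ext_eqI\<close> compares, for the left-hand side of (1);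
  the first two also place it in the fibre category of displays.\<close>

lemma
  assumes \<Gamma>: "\<Gamma> \<in> Obj C" and A: "A \<in> Obj (fib (Tp C) \<Gamma>)"
  defines "F\<Gamma> \<equiv> fobj (base F) \<Gamma>"
    and "Ap \<equiv> fobj (reind (Tp D) (nt \<alpha> \<Gamma>)) (fobj (mTp G \<Gamma>) A)"
    and "h \<equiv> ext_arr D (fobj (base F) \<Gamma>) (nTp \<alpha> \<Gamma> A) \<cdot>\<^bsub>D\<^esub> snd (snd (tau C D F \<Gamma> A))"
  shows comp_tau_hom: "h \<in> hom D (fobj (base F) (Dom C (ext C \<Gamma> A))) (Dom D (ext D F\<Gamma> Ap))"
    and ext_comp_tau: "ext D F\<Gamma> Ap \<cdot>\<^bsub>D\<^esub> h = farr (base F) (ext C \<Gamma> A)"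
    and var_comp_tau: "fobj (reind (Tm D) h) (var D F\<Gamma> Ap)
      = fobj (reind (Tm D) (nt \<alpha> (Dom C (ext C \<Gamma> A)))) (fobj (mTm G (Dom C (ext C \<Gamma> A))) (var C \<Gamma> A))"
proof -
  let ?E = "Dom C (ext C \<Gamma> A)" and ?FA = "fobj (mTp F \<Gamma>) A"
  note p = src.dom.ext_hom[OF \<Gamma> A] and v = src.dom.var_Obj[OF \<Gamma> A]
  have E: "?E \<in> Obj C" using p src.dom.hom_Obj by blast
  have F\<Gamma>: "F\<Gamma> \<in> Obj D" unfolding F\<Gamma>_def by (rule src.base.fobj_Obj[OF \<Gamma>])
  note t = src.tau_hom[OF \<Gamma> A, folded F\<Gamma>_def] src.ext_tau[OF \<Gamma> A, folded F\<Gamma>_def]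
    src.var_tau[OF \<Gamma> A, folded F\<Gamma>_def]
  note f = nTp_hom[OF \<Gamma> A, folded F\<Gamma>_def Ap_def]
  note e = src.cod.ext_arr_hom[OF F\<Gamma> f] src.cod.ext_ext_arr[OF F\<Gamma> f]
  have Ap: "Ap \<in> Obj (fib (Tp D) F\<Gamma>)"
    using category.hom_Obj[OF src.cod.ty.cod.fib_category[OF F\<Gamma>] f] ..
  note h_def = h_def[folded F\<Gamma>_def]
  show "h \<in> hom D (fobj (base F) ?E) (Dom D (ext D F\<Gamma> Ap))"
    unfolding h_def by (rule src.cod.Comp_hom[OF t(1) e(1)])
  show "ext D F\<Gamma> Ap \<cdot>\<^bsub>D\<^esub> h = farr (base F) (ext C \<Gamma> A)"
    using src.cod.Comp_assoc[OF t(1) e(1) src.cod.ext_hom[OF F\<Gamma> Ap]] e(2) t(2)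
    by (simp add: h_def)
  show "fobj (reind (Tm D) h) (var D F\<Gamma> Ap)
      = fobj (reind (Tm D) (nt \<alpha> ?E)) (fobj (mTm G ?E) (var C \<Gamma> A))"
    unfolding h_def
  proof (rule src.cod.var_ext_arr_comp[OF F\<Gamma> f t(1)])
    \<comment> \<open>The lift is the component of \<alpha> at the universal element: it starts at
      \<open>F v_A\<close>, which is the universal element over \<open>FA\<close> pulled back along
      \<open>tau\<close>.\<close>
    show "nTm \<alpha> ?E (var C \<Gamma> A) \<in> hom (fib (Tm D) (fobj (base F) ?E))
        (fobj (reind (Tm D) (snd (snd (tau C D F \<Gamma> A)))) (var D F\<Gamma> ?FA))
        (fobj (reind (Tm D) (nt \<alpha> ?E)) (fobj (mTm G ?E) (var C \<Gamma> A)))"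
      using nTm_hom[OF E v] by (simp add: t(3))
    \<comment> \<open>Compatibility with \<open>typeof\<close> gives the component at
      \<open>A[p_A]\<close>. Indexed naturality makes it \<open>nTp \<alpha> \<Gamma> A\<close>
      reindexed along \<open>F p_A\<close>, and \<open>F p_A\<close> is \<open>tau\<close> followed
      by the display of \<open>FA\<close>.\<close>
    show "farr (typeof D (fobj (base F) ?E)) (nTm \<alpha> ?E (var C \<Gamma> A))
        = farr (reind (Tp D) (ext D F\<Gamma> ?FA \<cdot>\<^bsub>D\<^esub> snd (snd (tau C D F \<Gamma> A)))) (nTp \<alpha> \<Gamma> A)"
      using typeof_component[OF E v] src.dom.typeof_var[OF \<Gamma> A] nTp.reind_component[OF p A] t(2)
      by simp
  qed
qed

text \<open>Phrased for underlying maps, so that it serves (1) and (2) alike. The right-hand side is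
  evaluated after composing with \<open>ext_top\<close>, where each map obtained from a pullback
  reduces to its prescribed component.\<close>

lemma comp_tau_eq_rho_tau:
  assumes \<Gamma>: "\<Gamma> \<in> Obj C" and A: "A \<in> Obj (fib (Tp C) \<Gamma>)"
  shows "ext_arr D (fobj (base F) \<Gamma>) (nTp \<alpha> \<Gamma> A) \<cdot>\<^bsub>D\<^esub> snd (snd (tau C D F \<Gamma> A)) =
    snd (snd (rho D (nt \<alpha> \<Gamma>) (fobj (mTp G \<Gamma>) A)))
    \<cdot>\<^bsub>D\<^esub> snd (snd (farr (disp_reind D (nt \<alpha> \<Gamma>)) (tau C D G \<Gamma> A)))
    \<cdot>\<^bsub>D\<^esub> snd (snd (disp_nat C D (base F) (base G) (nt \<alpha>) (ext C \<Gamma> A)))"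
proof -
  define u where "u = nt \<alpha> \<Gamma>"
  define F\<Gamma> where "F\<Gamma> = fobj (base F) \<Gamma>"
  define G\<Gamma> where "G\<Gamma> = fobj (base G) \<Gamma>"
  define E where "E = Dom C (ext C \<Gamma> A)"
  define GA where "GA = fobj (mTp G \<Gamma>) A"
  define Ap where "Ap = fobj (reind (Tp D) u) GA"
  define Fp where "Fp = farr (base F) (ext C \<Gamma> A)"
  define Gp where "Gp = farr (base G) (ext C \<Gamma> A)"
  define q where "q = ext D G\<Gamma> GA"
  define t where "t = snd (snd (tau C D G \<Gamma> A))"
  \<comment> \<open>\<open>r\<close>, \<open>k\<close> and \<open>n\<close> are the underlying maps
    of \<open>rho\<close>, of the reindexed \<open>tau\<close> of \<open>G\<close>, and of
    \<open>disp_nat\<close>. The last two are spelled out as induced maps and identified with the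
    official ones at the end.\<close>
  define r where "r = snd (snd (rho D u GA))"
  define k where "k = pb_induced D u q (pb D u Gp) (t \<cdot>\<^bsub>D\<^esub> pb_top D u Gp)"
  define n where "n = pb_induced D u Gp Fp (nt \<alpha> E)"
  have p: "ext C \<Gamma> A \<in> hom C E \<Gamma>" unfolding E_def by (rule src.dom.ext_hom[OF \<Gamma> A])
  have pD: "ext C \<Gamma> A \<in> Displays C" using src.dom.ext_Displays[OF \<Gamma> A] ..
  have E: "E \<in> Obj C" using p src.dom.hom_Obj by blast
  have u: "u \<in> hom D F\<Gamma> G\<Gamma>" unfolding u_def F\<Gamma>_def G\<Gamma>_def by (rule nt.component_hom[OF \<Gamma>])
  have F\<Gamma>: "F\<Gamma> \<in> Obj D" and G\<Gamma>: "G\<Gamma> \<in> Obj D" using u src.cod.hom_Obj by auto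
  have GA: "GA \<in> Obj (fib (Tp D) G\<Gamma>)" unfolding GA_def G\<Gamma>_def by (rule trg.mTp_Obj[OF \<Gamma> A])
  have Ap: "Ap \<in> Obj (fib (Tp D) F\<Gamma>)" unfolding Ap_def by (rule src.cod.ty.cod.reind_Obj[OF u GA])
  have Fp: "Fp \<in> hom D (fobj (base F) E) F\<Gamma>"
    unfolding Fp_def F\<Gamma>_def by (rule src.base.farr_hom[OF p])
  have Gp: "Gp \<in> hom D (fobj (base G) E) G\<Gamma>"
    unfolding Gp_def G\<Gamma>_def by (rule trg.base.farr_hom[OF p])
  have GpD: "Gp \<in> Displays D" "Cod D Gp = G\<Gamma>" and DGp: "Dom D Gp = fobj (base G) E"
    using trg.base.farr_Displays[OF pD] Gp by (auto simp: Gp_def hom_def)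
  have q: "q \<in> hom D (Dom D q) G\<Gamma>" unfolding q_def by (rule src.cod.ext_hom[OF G\<Gamma> GA])
  have qD: "q \<in> Displays D" "Cod D q = G\<Gamma>"
    using src.cod.ext_Displays[OF G\<Gamma> GA] by (auto simp: q_def)
  have aE: "nt \<alpha> E \<in> hom D (fobj (base F) E) (fobj (base G) E)" by (rule nt.component_hom[OF E])
  \<comment> \<open>Naturality of \<alpha> at \<open>p_A\<close> is exactly the compatibility
    required for \<open>n\<close>.\<close>
  have nat: "Gp \<cdot>\<^bsub>D\<^esub> nt \<alpha> E = u \<cdot>\<^bsub>D\<^esub> Fp"
    using nt.naturality[OF p] by (simp add: Gp_def Fp_def u_def)
  note t = trg.tau_hom[OF \<Gamma> A, folded t_def GA_def G\<Gamma>_def E_def q_def]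
    trg.ext_tau[OF \<Gamma> A, folded t_def GA_def G\<Gamma>_def q_def Gp_def]
    trg.var_tau[OF \<Gamma> A, folded t_def GA_def G\<Gamma>_def E_def]
  note sq = src.cod.pb_square[OF GpD u, unfolded DGp]
  note n = src.cod.pb_induced[OF GpD u Fp aE[folded DGp] nat, folded n_def, unfolded DGp]
  \<comment> \<open>The compatibility required for \<open>k\<close>: as \<open>q\<close> after
    \<open>t\<close> is \<open>Gp\<close>, this is the chosen pullback square of
    \<open>Gp\<close>.\<close>
  have "q \<cdot>\<^bsub>D\<^esub> t \<cdot>\<^bsub>D\<^esub> pb_top D u Gp = u \<cdot>\<^bsub>D\<^esub> pb D u Gp"
    using src.cod.Comp_assoc[OF sq(2) t(1) q] t(2) sq(3) by simp
  note k = src.cod.pb_induced[OF qD u sq(1) src.cod.Comp_hom[OF sq(2) t(1)] this, folded k_def]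
  note r = src.cod.rho_hom[OF u GA, folded r_def q_def Ap_def]
    src.cod.ext_rho[OF u GA, folded r_def q_def Ap_def]
    src.cod.ext_top_rho[OF u GA, folded r_def q_def Ap_def]
  note top = src.cod.ext_top_hom[OF u GA, folded q_def Ap_def]
    src.cod.var_ext_top[OF u GA, folded Ap_def]
  note kn = src.cod.Comp_hom[OF n(1) k(1)]
  note rkn = src.cod.Comp_hom[OF kn r(1)]
  note pq = src.cod.pb_square[OF qD u]
  \<comment> \<open>The projections are peeled off from the left: \<open>r\<close> turns
    \<open>ext_top\<close> into the chosen projection for \<open>q\<close>, \<open>k\<close> turns
    that into \<open>t\<close> after the projection for \<open>Gp\<close>, and \<open>n\<close>
    leaves the component of \<alpha>.\<close>
  have "ext_top D u GA \<cdot>\<^bsub>D\<^esub> r \<cdot>\<^bsub>D\<^esub> k \<cdot>\<^bsub>D\<^esub> n = pb_top D u q \<cdot>\<^bsub>D\<^esub> k \<cdot>\<^bsub>D\<^esub> n"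
    using src.cod.Comp_assoc[OF kn r(1) top(1)] r(3) by simp
  also have "\<dots> = (t \<cdot>\<^bsub>D\<^esub> pb_top D u Gp) \<cdot>\<^bsub>D\<^esub> n"
    using src.cod.Comp_assoc[OF n(1) k(1) pq(2)] k(3) by simp
  also have "\<dots> = t \<cdot>\<^bsub>D\<^esub> nt \<alpha> E"
    using src.cod.Comp_assoc[OF n(1) sq(2) t(1)] n(3) by simp
  finally have top_rkn: "ext_top D u GA \<cdot>\<^bsub>D\<^esub> r \<cdot>\<^bsub>D\<^esub> k \<cdot>\<^bsub>D\<^esub> n = t \<cdot>\<^bsub>D\<^esub> nt \<alpha> E" .
  \<comment> \<open>The universal element over \<open>Ap\<close> is the one over \<open>GA\<close>
    pulled back along \<open>ext_top\<close>, so the previous computation decides the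
    matter.\<close>
  have "fobj (reind (Tm D) (r \<cdot>\<^bsub>D\<^esub> k \<cdot>\<^bsub>D\<^esub> n)) (var D F\<Gamma> Ap)
      = fobj (reind (Tm D) (ext_top D u GA \<cdot>\<^bsub>D\<^esub> r \<cdot>\<^bsub>D\<^esub> k \<cdot>\<^bsub>D\<^esub> n)) (var D G\<Gamma> GA)"
    using src.cod.ty.dom.reind_Comp_obj[OF rkn top(1)] src.cod.var_Obj[OF G\<Gamma> GA] top(2)
    by (simp add: q_def)
  also have "\<dots> = fobj (reind (Tm D) (nt \<alpha> E)) (fobj (mTm G E) (var C \<Gamma> A))"
    using src.cod.ty.dom.reind_Comp_obj[OF aE t(1)] src.cod.var_Obj[OF G\<Gamma> GA] t(3)
    by (simp add: top_rkn q_def)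
  finally have var: "fobj (reind (Tm D) (r \<cdot>\<^bsub>D\<^esub> k \<cdot>\<^bsub>D\<^esub> n)) (var D F\<Gamma> Ap)
      = fobj (reind (Tm D) (nt \<alpha> E)) (fobj (mTm G E) (var C \<Gamma> A))" .
  have over: "ext D F\<Gamma> Ap \<cdot>\<^bsub>D\<^esub> r \<cdot>\<^bsub>D\<^esub> k \<cdot>\<^bsub>D\<^esub> n = Fp"
    using src.cod.Comp_assoc[OF kn r(1) src.cod.ext_hom[OF F\<Gamma> Ap]] r(2)
      src.cod.Comp_assoc[OF n(1) k(1) pq(1)] k(2) n(2) by simp
  let ?h = "ext_arr D F\<Gamma> (nTp \<alpha> \<Gamma> A) \<cdot>\<^bsub>D\<^esub> snd (snd (tau C D F \<Gamma> A))"
  have "?h = r \<cdot>\<^bsub>D\<^esub> k \<cdot>\<^bsub>D\<^esub> n"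
  proof (rule src.cod.ext_eqI[OF F\<Gamma> Ap _ rkn])
    show "?h \<in> hom D (fobj (base F) E) (Dom D (ext D F\<Gamma> Ap))"
      using comp_tau_hom[OF \<Gamma> A] by (simp add: F\<Gamma>_def E_def Ap_def GA_def u_def)
    show "ext D F\<Gamma> Ap \<cdot>\<^bsub>D\<^esub> ?h = ext D F\<Gamma> Ap \<cdot>\<^bsub>D\<^esub> r \<cdot>\<^bsub>D\<^esub> k \<cdot>\<^bsub>D\<^esub> n"
      unfolding over using ext_comp_tau[OF \<Gamma> A]
      by (simp add: F\<Gamma>_def E_def Ap_def GA_def u_def Fp_def)
    show "fobj (reind (Tm D) ?h) (var D F\<Gamma> Ap)
        = fobj (reind (Tm D) (r \<cdot>\<^bsub>D\<^esub> k \<cdot>\<^bsub>D\<^esub> n)) (var D F\<Gamma> Ap)"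
      unfolding var using var_comp_tau[OF \<Gamma> A]
      by (simp add: F\<Gamma>_def E_def Ap_def GA_def u_def)
  qed
  \<comment> \<open>\<open>tau\<close> is first rewritten as a triple, on which
    \<open>disp_reind\<close> can match.\<close>
  moreover have "k = snd (snd (farr (disp_reind D u) (tau C D G \<Gamma> A)))"
    by (subst trg.tau_eq[OF \<Gamma> A])
      (simp add: disp_reind_def k_def t_def q_def Gp_def GA_def G\<Gamma>_def)
  moreover have "n = snd (snd (disp_nat C D (base F) (base G) (nt \<alpha>) (ext C \<Gamma> A)))"
    using hom_Dom_Cod[OF p] by (simp add: disp_nat_def n_def u_def Gp_def Fp_def)
  ultimately show ?thesis by (simp add: F\<Gamma>_def r_def u_def GA_def)
qed

text \<open>Provides the hom-set claim of (1), and the unpointed part of that of (2).\<close>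

lemma comp_tau_in_disp_fib:
  assumes \<Gamma>: "\<Gamma> \<in> Obj C" and A: "A \<in> Obj (fib (Tp C) \<Gamma>)"
  defines "F\<Gamma> \<equiv> fobj (base F) \<Gamma>"
    and "Ap \<equiv> fobj (reind (Tp D) (nt \<alpha> \<Gamma>)) (fobj (mTp G \<Gamma>) A)"
  shows "(farr (base F) (ext C \<Gamma> A), ext D F\<Gamma> Ap,
      ext_arr D F\<Gamma> (nTp \<alpha> \<Gamma> A) \<cdot>\<^bsub>D\<^esub> snd (snd (tau C D F \<Gamma> A))) \<in> Arr (disp_fib D F\<Gamma>)"
proof -
  have F\<Gamma>: "F\<Gamma> \<in> Obj D" unfolding F\<Gamma>_def by (rule src.base.fobj_Obj[OF \<Gamma>])
  have "Ap \<in> Obj (fib (Tp D) F\<Gamma>)"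
    unfolding Ap_def F\<Gamma>_def
    by (rule src.cod.ty.cod.reind_Obj[OF nt.component_hom[OF \<Gamma>] trg.mTp_Obj[OF \<Gamma> A]])
  from src.cod.ext_Displays[OF F\<Gamma> this] show ?thesis
    using src.base.farr_Displays[of "ext C \<Gamma> A"] src.dom.ext_Displays[OF \<Gamma> A]
      hom_Dom_Cod[OF src.base.farr_hom[OF src.dom.ext_hom[OF \<Gamma> A]]]
      comp_tau_hom[OF \<Gamma> A] ext_comp_tau[OF \<Gamma> A]
    by (simp add: disp_fib_def F\<Gamma>_def Ap_def)
qed

text \<open>Two stages: \<open>tau\<close> carries the image of the section of \<open>a\<close> to
  the section of \<open>Fa\<close>, and comprehension carries this on along the component of
  \<alpha> at \<open>a\<close>, which lies over the component at \<open>A\<close>.\<close>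

lemma comp_tau_tm_section:
  assumes \<Gamma>: "\<Gamma> \<in> Obj C" and a: "a \<in> Obj (fib (Tm C) \<Gamma>)"
  defines "A \<equiv> fobj (typeof C \<Gamma>) a"
  shows "(ext_arr D (fobj (base F) \<Gamma>) (nTp \<alpha> \<Gamma> A) \<cdot>\<^bsub>D\<^esub> snd (snd (tau C D F \<Gamma> A)))
      \<cdot>\<^bsub>D\<^esub> farr (base F) (tm_section C \<Gamma> a)
    = tm_section D (fobj (base F) \<Gamma>) (fobj (reind (Tm D) (nt \<alpha> \<Gamma>)) (fobj (mTm G \<Gamma>) a))"
proof -
  have A: "A \<in> Obj (fib (Tp C) \<Gamma>)" unfolding A_def by (rule src.dom.typeof_Obj[OF \<Gamma> a])
  have F\<Gamma>: "fobj (base F) \<Gamma> \<in> Obj D" by (rule src.base.fobj_Obj[OF \<Gamma>])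
  show ?thesis
    using src.cod.Comp_assoc[OF src.base.farr_hom[OF src.dom.tm_section_hom[OF \<Gamma> a]]
        src.tau_hom[OF \<Gamma> A, unfolded A_def] src.cod.ext_arr_hom[OF F\<Gamma> nTp_hom[OF \<Gamma> A], unfolded A_def]]
      src.tau_tm_section[OF \<Gamma> a] src.cod.ext_arr_tm_section[OF F\<Gamma> nTm_hom[OF \<Gamma> a]]
      typeof_component[OF \<Gamma> a]
    by (simp add: A_def)
qed

end

section \<open>The two equations as equalities of arrows in the fibres\<close>

theorem lemma3p2p8:
  fixes C :: "('o, 'm, 'a, 'b, 't, 'x) pnm"
    and D :: "('p, 'n, 'c, 'd, 's, 'y) pnm"
    and F G :: "('o, 'm, 'a, 'b, 't, 'x, 'p, 'n, 'c, 'd, 's, 'y) pnm_mor"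
    and \<alpha> :: "('o, 'a, 't, 'n, 'd, 'y) pnm_2mor"
  assumes "pre_natural_model C" and "pre_natural_model D"
    and "pnm_morphism C D F" and "pnm_morphism C D G"
    and "pnm_2morphism C D F G \<alpha>"
  shows "(\<forall>\<Gamma> \<in> Obj C. \<forall>A \<in> Obj (fib (Tp C) \<Gamma>).
      (let F\<Gamma> = fobj (base F) \<Gamma>;
           \<alpha>\<Gamma> = nt \<alpha> \<Gamma>;
           GA = fobj (mTp G \<Gamma>) A;
           p = ext C \<Gamma> A;
           DF = fib (disp_indexed D) F\<Gamma>;
           H = hom DF (farr (base F) p)
                 (fobj (comprehension D F\<Gamma>) (fobj (reind (Tp D) \<alpha>\<Gamma>) GA));
           lhs = farr (comprehension D F\<Gamma>) (nTp \<alpha> \<Gamma> A) \<cdot>\<^bsub>DF\<^esub> tau C D F \<Gamma> A;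
           rhs = rho D \<alpha>\<Gamma> GA
                 \<cdot>\<^bsub>DF\<^esub> farr (reind (disp_indexed D) \<alpha>\<Gamma>) (tau C D G \<Gamma> A)
                 \<cdot>\<^bsub>DF\<^esub> disp_nat C D (base F) (base G) (nt \<alpha>) p
       in lhs \<in> H \<and> rhs \<in> H \<and> lhs = rhs)) \<and>
    (\<forall>\<Gamma> \<in> Obj C. \<forall>a \<in> Obj (fib (Tm C) \<Gamma>).
      (let F\<Gamma> = fobj (base F) \<Gamma>;
           \<alpha>\<Gamma> = nt \<alpha> \<Gamma>;
           Ga = fobj (mTm G \<Gamma>) a;
           p = ext C \<Gamma> (fobj (typeof C \<Gamma>) a);
           s = tm_section C \<Gamma> a;
           DF = fib (pdisp_indexed D) F\<Gamma>;
           H = hom DF (farr (base F) p, farr (base F) s)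
                 (fobj (pcomprehension D F\<Gamma>) (fobj (reind (Tm D) \<alpha>\<Gamma>) Ga));
           lhs = farr (pcomprehension D F\<Gamma>) (nTm \<alpha> \<Gamma> a) \<cdot>\<^bsub>DF\<^esub> ptau C D F \<Gamma> a;
           rhs = prho D \<alpha>\<Gamma> Ga
                 \<cdot>\<^bsub>DF\<^esub> farr (reind (pdisp_indexed D) \<alpha>\<Gamma>) (ptau C D G \<Gamma> a)
                 \<cdot>\<^bsub>DF\<^esub> pdisp_nat C D (base F) (base G) (nt \<alpha>) (p, s)
       in lhs \<in> H \<and> rhs \<in> H \<and> lhs = rhs))"
proof (intro conjI ballI)
  interpret pnm_2morphism C D F G \<alpha> by fact
  fix \<Gamma> A assume \<Gamma>: "\<Gamma> \<in> Obj C" and A: "A \<in> Obj (fib (Tp C) \<Gamma>)"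
  let ?F\<Gamma> = "fobj (base F) \<Gamma>" and ?GA = "fobj (mTp G \<Gamma>) A" and ?u = "nt \<alpha> \<Gamma>"
  let ?p = "ext C \<Gamma> A" and ?GAu = "fobj (reind (Tp D) (nt \<alpha> \<Gamma>)) (fobj (mTp G \<Gamma>) A)"
  define lhs where "lhs = farr (comprehension D ?F\<Gamma>) (nTp \<alpha> \<Gamma> A) \<cdot>\<^bsub>disp_fib D ?F\<Gamma>\<^esub> tau C D F \<Gamma> A"
  define rhs where "rhs = rho D ?u ?GA
    \<cdot>\<^bsub>disp_fib D ?F\<Gamma>\<^esub> farr (disp_reind D ?u) (tau C D G \<Gamma> A)
    \<cdot>\<^bsub>disp_fib D ?F\<Gamma>\<^esub> disp_nat C D (base F) (base G) (nt \<alpha>) ?p"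
  let ?h = "ext_arr D ?F\<Gamma> (nTp \<alpha> \<Gamma> A) \<cdot>\<^bsub>D\<^esub> snd (snd (tau C D F \<Gamma> A))"
  have lhs: "lhs = (farr (base F) ?p, ext D ?F\<Gamma> ?GAu, ?h)"
    unfolding lhs_def using hom_Dom_Cod[OF nTp_hom[OF \<Gamma> A]]
    by (subst src.tau_eq[OF \<Gamma> A]) (simp add: disp_fib_def comprehension_def)
  have rhs: "rhs = (farr (base F) ?p, ext D ?F\<Gamma> ?GAu, ?h)"
    unfolding rhs_def comp_tau_eq_rho_tau[OF \<Gamma> A]
    by (subst src.cod.rho_eq[OF nt.component_hom[OF \<Gamma>] trg.mTp_Obj[OF \<Gamma> A]])
      (simp add: disp_fib_def disp_nat_def split_beta)
  \<comment> \<open>Both sides are now the same triple, so one membership settles both hom-set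
    claims.\<close>
  have "lhs \<in> hom (disp_fib D ?F\<Gamma>) (farr (base F) ?p) (ext D ?F\<Gamma> ?GAu)"
    unfolding lhs using comp_tau_in_disp_fib[OF \<Gamma> A] by (simp add: hom_def disp_fib_def)
  then show "let F\<Gamma> = fobj (base F) \<Gamma>;
           \<alpha>\<Gamma> = nt \<alpha> \<Gamma>;
           GA = fobj (mTp G \<Gamma>) A;
           p = ext C \<Gamma> A;
           DF = fib (disp_indexed D) F\<Gamma>;
           H = hom DF (farr (base F) p)
                 (fobj (comprehension D F\<Gamma>) (fobj (reind (Tp D) \<alpha>\<Gamma>) GA));
           lhs = farr (comprehension D F\<Gamma>) (nTp \<alpha> \<Gamma> A) \<cdot>\<^bsub>DF\<^esub> tau C D F \<Gamma> A;
           rhs = rho D \<alpha>\<Gamma> GA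
                 \<cdot>\<^bsub>DF\<^esub> farr (reind (disp_indexed D) \<alpha>\<Gamma>) (tau C D G \<Gamma> A)
                 \<cdot>\<^bsub>DF\<^esub> disp_nat C D (base F) (base G) (nt \<alpha>) p
       in lhs \<in> H \<and> rhs \<in> H \<and> lhs = rhs"
    unfolding Let_def disp_indexed_def indexed_cat.simps lhs_def[symmetric] rhs_def[symmetric]
    using lhs rhs by (simp add: comprehension_def)
next
  interpret pnm_2morphism C D F G \<alpha> by fact
  fix \<Gamma> a assume \<Gamma>: "\<Gamma> \<in> Obj C" and a: "a \<in> Obj (fib (Tm C) \<Gamma>)"
  let ?F\<Gamma> = "fobj (base F) \<Gamma>" and ?Ga = "fobj (mTm G \<Gamma>) a" and ?u = "nt \<alpha> \<Gamma>"
  let ?A = "fobj (typeof C \<Gamma>) a"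
  let ?p = "ext C \<Gamma> ?A" and ?s = "tm_section C \<Gamma> a"
  let ?Gau = "fobj (reind (Tm D) ?u) ?Ga"
  let ?ps = "(farr (base F) ?p, farr (base F) ?s)"
  define lhs where "lhs = farr (pcomprehension D ?F\<Gamma>) (nTm \<alpha> \<Gamma> a) \<cdot>\<^bsub>pdisp_fib D ?F\<Gamma>\<^esub> ptau C D F \<Gamma> a"
  define rhs where "rhs = prho D ?u ?Ga
    \<cdot>\<^bsub>pdisp_fib D ?F\<Gamma>\<^esub> farr (pdisp_reind D ?u) (ptau C D G \<Gamma> a)
    \<cdot>\<^bsub>pdisp_fib D ?F\<Gamma>\<^esub> pdisp_nat C D (base F) (base G) (nt \<alpha>) (?p, ?s)"
  let ?h = "ext_arr D ?F\<Gamma> (nTp \<alpha> \<Gamma> ?A) \<cdot>\<^bsub>D\<^esub> snd (snd (tau C D F \<Gamma> ?A))"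
  have A: "?A \<in> Obj (fib (Tp C) \<Gamma>)" by (rule src.dom.typeof_Obj[OF \<Gamma> a])
  have F\<Gamma>: "?F\<Gamma> \<in> Obj D" by (rule src.base.fobj_Obj[OF \<Gamma>])
  have Ga: "fobj (typeof D (fobj (base G) \<Gamma>)) ?Ga = fobj (mTp G \<Gamma>) ?A"
    by (rule trg.typeof_obj[OF \<Gamma> a])
  have u: "?u \<in> hom D ?F\<Gamma> (fobj (base G) \<Gamma>)" by (rule nt.component_hom[OF \<Gamma>])
  have Gau: "?Gau \<in> Obj (fib (Tm D) ?F\<Gamma>)"
    by (rule src.cod.ty.dom.reind_Obj[OF u trg.mTm_Obj[OF \<Gamma> a]])
  have typeof_Gau: "fobj (typeof D ?F\<Gamma>) ?Gau = fobj (reind (Tp D) ?u) (fobj (mTp G \<Gamma>) ?A)"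
    using src.cod.ty.strict_nat_obj[OF u trg.mTm_Obj[OF \<Gamma> a]] Ga by simp
  have lhs: "lhs = (?ps, fobj (pcomprehension D ?F\<Gamma>) ?Gau, ?h)"
    unfolding lhs_def
    using hom_Dom_Cod[OF nTm_hom[OF \<Gamma> a]] typeof_component[OF \<Gamma> a]
    by (simp add: pdisp_fib_def pcomprehension_def comprehension_def ptau_def Let_def)
  \<comment> \<open>Pointed reindexing takes its underlying map from \<open>disp_reind\<close>,
    applied to the displays of source and target; \<open>Ga\<close> identifies the target display
    with that of \<open>tau\<close>.\<close>
  have re: "snd (snd (farr (pdisp_reind D ?u) (ptau C D G \<Gamma> a)))
      = snd (snd (farr (disp_reind D ?u) (tau C D G \<Gamma> ?A)))"
    by (subst trg.tau_eq[OF \<Gamma> A])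
      (simp add: pdisp_reind_def ptau_def pcomprehension_def Let_def Ga)
  have rhs: "rhs = (?ps, fobj (pcomprehension D ?F\<Gamma>) ?Gau, ?h)"
    unfolding rhs_def comp_tau_eq_rho_tau[OF \<Gamma> A] re[symmetric]
    using hom_Dom_Cod[OF u] Ga
    by (simp add: pdisp_fib_def prho_def pdisp_nat_def split_beta)
  \<comment> \<open>What an arrow of \<open>pdisp_fib\<close> needs beyond one of
    \<open>disp_fib\<close>: preservation of the sections, and that they are sections.\<close>
  have "?h \<cdot>\<^bsub>D\<^esub> farr (base F) ?s = tm_section D ?F\<Gamma> ?Gau"
    by (rule comp_tau_tm_section[OF \<Gamma> a])
  moreover have "is_section D (farr (base F) ?p) (farr (base F) ?s)"
    by (rule src.is_section_farr[OF \<Gamma> src.dom.ext_hom[OF \<Gamma> A]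
          src.dom.is_section_tm_section[OF \<Gamma> a]])
  moreover have "is_section D (ext D ?F\<Gamma> (fobj (typeof D ?F\<Gamma>) ?Gau)) (tm_section D ?F\<Gamma> ?Gau)"
    by (rule src.cod.is_section_tm_section[OF F\<Gamma> Gau])
  ultimately have "lhs \<in> hom (pdisp_fib D ?F\<Gamma>) ?ps (fobj (pcomprehension D ?F\<Gamma>) ?Gau)"
    unfolding lhs using comp_tau_in_disp_fib[OF \<Gamma> A]
    by (simp add: hom_def pdisp_fib_def pcomprehension_def Let_def typeof_Gau)
  then show "let F\<Gamma> = fobj (base F) \<Gamma>;
           \<alpha>\<Gamma> = nt \<alpha> \<Gamma>;
           Ga = fobj (mTm G \<Gamma>) a;
           p = ext C \<Gamma> (fobj (typeof C \<Gamma>) a);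
           s = tm_section C \<Gamma> a;
           DF = fib (pdisp_indexed D) F\<Gamma>;
           H = hom DF (farr (base F) p, farr (base F) s)
                 (fobj (pcomprehension D F\<Gamma>) (fobj (reind (Tm D) \<alpha>\<Gamma>) Ga));
           lhs = farr (pcomprehension D F\<Gamma>) (nTm \<alpha> \<Gamma> a) \<cdot>\<^bsub>DF\<^esub> ptau C D F \<Gamma> a;
           rhs = prho D \<alpha>\<Gamma> Ga
                 \<cdot>\<^bsub>DF\<^esub> farr (reind (pdisp_indexed D) \<alpha>\<Gamma>) (ptau C D G \<Gamma> a)
                 \<cdot>\<^bsub>DF\<^esub> pdisp_nat C D (base F) (base G) (nt \<alpha>) (p, s)
       in lhs \<in> H \<and> rhs \<in> H \<and> lhs = rhs"
    unfolding Let_def pdisp_indexed_def indexed_cat.simps lhs_def[symmetric] rhs_def[symmetric]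
    using lhs rhs by simp
qed

end
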